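(* Suppose the change-point and response models depend on an unknown random parameter $\eta$ with prior distribution $\tilde\mu$ on a Polish space $\mathcal H$. Fix an assignment rule $\mathcal X$ and an integer $t\ge0$. For any measurable subset $C\subset\mathcal H$, almost surely, $$\mathsf P(\eta\in C\mid\mathcal F_t)=\frac{\int D_{t,\tilde\eta}(1+\Gamma_{t,\tilde\eta})\mathbf 1\{\tilde\eta\in C\}\,d\tilde\mu(\tilde\eta)}{\int D_{t,\tilde\eta}(1+\Gamma_{t,\tilde\eta})\,d\tilde\mu(\tilde\eta)}.$$
   Context: Setup. Fix $2\le K<\infty$, $[K]=\{1,\dots,K\}$, $\mathbb N=\{1,2,\dots\}$. There is a latent process $L_t\in\{0,1\}$, $t\ge0$, with $L_t=0$ for $t<\Theta$ and $L_t=1$ for $t\ge\Theta$ ($\Theta$ is the change-point). At each $t\in\mathbb N$ a treatment $X_t\in[K]$ is selected and a response $Y_t$ in a Polish space $\mathbb Y$ is observed; $\mathcal F_t=\sigma(X_s,Y_s:1\le s\le t)$, and $\mathcal F_0$ is trivial. An assignment rule is a sequence $\mathcal X=\{X_t,t\in\mathbb N\}$ with $X_1$ deterministic and $X_t$ a deterministic (measurable) function of $X_1,\dots,X_{t-1},Y_1,\dots,Y_{t-1}$ for $t\ge2$. Parametric models: $\eta$ is random with law $\tilde\mu$ on the Polish space $\mathcal H$. For each $\eta\in\mathcal H$ there are $\pi_{0,\eta}\in[0,1)$, functions $\pi_{t,\eta}:[K]^t\to[0,1)$, $t\in\mathbb N$, and densities $f_{x,\eta},g_{x,\eta}$, $x\in[K]$,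 with respect to a $\sigma$-finite measure $\mu$ on the Borel $\sigma$-algebra of $\mathbb Y$. Conditionally on $\eta$: $\mathsf P(L_0=1)=\pi_{0,\eta}$; given $L_{t-1}=0$, $\mathcal F_{t-1}$ and $X_t$, $L_t=1$ with probability $\Pi_{t,\eta}=\pi_{t,\eta}(X_1,\dots,X_t)$; given $X_t=x$, $L_t=i$, $\mathcal F_{t-1}$ and $L_0,\dots,L_{t-1}$, the response $Y_t$ has density $f_{x,\eta}$ if $i=0$ and $g_{x,\eta}$ if $i=1$. Definitions: $\Gamma_{0,\eta}=\pi_{0,\eta}/(1-\pi_{0,\eta})$ and, for $t\in\mathbb N$, $\Gamma_{t,\eta}=(\Gamma_{t-1,\eta}+\Pi_{t,\eta})\dfrac{\Lambda_{t,\eta}}{1-\Pi_{t,\eta}}$ with $\Lambda_{t,\eta}=\dfrac{g_{X_t,\eta}(Y_t)}{f_{X_t,\eta}(Y_t)}$; $D_{0,\eta}=1-\pi_{0,\eta}$ and $D_{t,\eta}=D_{0,\eta}\prod_{s=1}^t(1-\Pi_{s,\eta})f_{X_s,\eta}(Y_s)$ for $t\ge1$.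
   Formalization: The formal statement adds that, for every treatment x and parameter η, g_{x,η}=0 for μ-almost every y with f_{x,η}(y)=0; otherwise Λ=g/f, and so D(1+Γ), is undefined (0·∞) with positive probability; measurability of π, f, g in η is also made explicit. *)

theory Defs
  imports "HOL-Probability.Probability"
begin

definition rv_events :: "'w measure \<Rightarrow> 'b measure \<Rightarrow> ('w \<Rightarrow> 'b) \<Rightarrow> 'w set set" where
  "rv_events M N Z = sets (vimage_algebra (space M) Z N)"

definition obs_events ::
  "'w measure \<Rightarrow> (nat \<Rightarrow> 'w \<Rightarrow> nat) \<Rightarrow> (nat \<Rightarrow> 'w \<Rightarrow> 'y::topological_space) \<Rightarrow> nat \<Rightarrow> 'w set set" where
  "obs_events M X Y t =
     (\<Union>s\<in>{1..t}. rv_events M (count_space UNIV) (X s) \<union> rv_events M borel (Y s))"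

definition obs_sigma ::
  "'w measure \<Rightarrow> (nat \<Rightarrow> 'w \<Rightarrow> nat) \<Rightarrow> (nat \<Rightarrow> 'w \<Rightarrow> 'y::topological_space) \<Rightarrow> nat \<Rightarrow> 'w measure" where
  "obs_sigma M X Y t = sigma (space M) (obs_events M X Y t)"

text \<open>The change-point may be infinite (no change ever occurs).\<close>

definition latent :: "('w \<Rightarrow> enat) \<Rightarrow> nat \<Rightarrow> 'w \<Rightarrow> nat" where
  "latent \<Theta> t \<omega> = (if enat t < \<Theta> \<omega> then 0 else 1)"

definition assignment_rule ::
  "'w measure \<Rightarrow> nat \<Rightarrow> (nat \<Rightarrow> 'w \<Rightarrow> nat) \<Rightarrow> (nat \<Rightarrow> 'w \<Rightarrow> 'y::topological_space) \<Rightarrow> bool" where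
  "assignment_rule M K X Y \<longleftrightarrow>
     (\<exists>x\<in>{1..K}. \<forall>\<omega>\<in>space M. X 1 \<omega> = x) \<and>
     (\<forall>t\<ge>2. \<exists>\<phi> \<in> (PiM {1..<t} (\<lambda>_. count_space {1..K}) \<Otimes>\<^sub>M PiM {1..<t} (\<lambda>_. borel))
                     \<rightarrow>\<^sub>M count_space {1..K}.
        \<forall>\<omega>\<in>space M. X t \<omega> = \<phi> (\<lambda>s\<in>{1..<t}. X s \<omega>, \<lambda>s\<in>{1..<t}. Y s \<omega>))"

text \<open>
  In the next four definitions \<open>x\<close> and \<open>y\<close> are the sequences of treatments and responses; only
  their entries with index at least 1 are used.  An element of \<open>[K]\<^sup>t\<close> is a list of length \<open>t\<close>.
\<close>

definition trans_prob ::
  "(nat \<Rightarrow> 'h \<Rightarrow> nat list \<Rightarrow> real) \<Rightarrow> (nat \<Rightarrow> nat) \<Rightarrow> nat \<Rightarrow> 'h \<Rightarrow> real" where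
  "trans_prob p x t h = p t h (map x [1..<Suc t])"

definition lik_ratio ::
  "(nat \<Rightarrow> 'h \<Rightarrow> 'y \<Rightarrow> real) \<Rightarrow> (nat \<Rightarrow> 'h \<Rightarrow> 'y \<Rightarrow> real) \<Rightarrow>
   (nat \<Rightarrow> nat) \<Rightarrow> (nat \<Rightarrow> 'y) \<Rightarrow> nat \<Rightarrow> 'h \<Rightarrow> real" where
  "lik_ratio f g x y t h = g (x t) h (y t) / f (x t) h (y t)"

primrec post_odds ::
  "('h \<Rightarrow> real) \<Rightarrow> (nat \<Rightarrow> 'h \<Rightarrow> nat list \<Rightarrow> real) \<Rightarrow>
   (nat \<Rightarrow> 'h \<Rightarrow> 'y \<Rightarrow> real) \<Rightarrow> (nat \<Rightarrow> 'h \<Rightarrow> 'y \<Rightarrow> real) \<Rightarrow>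
   (nat \<Rightarrow> nat) \<Rightarrow> (nat \<Rightarrow> 'y) \<Rightarrow> nat \<Rightarrow> 'h \<Rightarrow> real" where
  "post_odds p0 p f g x y 0 h = p0 h / (1 - p0 h)"
| "post_odds p0 p f g x y (Suc t) h =
     (post_odds p0 p f g x y t h + trans_prob p x (Suc t) h) *
     (lik_ratio f g x y (Suc t) h / (1 - trans_prob p x (Suc t) h))"

definition no_change_dens ::
  "('h \<Rightarrow> real) \<Rightarrow> (nat \<Rightarrow> 'h \<Rightarrow> nat list \<Rightarrow> real) \<Rightarrow> (nat \<Rightarrow> 'h \<Rightarrow> 'y \<Rightarrow> real) \<Rightarrow>
   (nat \<Rightarrow> nat) \<Rightarrow> (nat \<Rightarrow> 'y) \<Rightarrow> nat \<Rightarrow> 'h \<Rightarrow> real" where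
  "no_change_dens p0 p f x y t h =
     (1 - p0 h) * (\<Prod>s=1..t. (1 - trans_prob p x s h) * f (x s) h (y s))"

text \<open>
  Conditioning on \<open>\<eta>\<close> together with further variables is conditioning on the \<open>\<sigma>\<close>-algebra they
  jointly generate.  The assumption \<open>abs_cont\<close> says that the likelihood ratio is well defined
  up to null sets, since real division by zero yields zero.
\<close>

locale change_point_model =
  prob_space M + resp: sigma_finite_measure \<mu>
  for M :: "'w measure" and \<mu> :: "'y::polish_space measure" +
  fixes K :: nat
    and prior :: "'h::polish_space measure"
    and p0 :: "'h \<Rightarrow> real"
    and p :: "nat \<Rightarrow> 'h \<Rightarrow> nat list \<Rightarrow> real"
    and f g :: "nat \<Rightarrow> 'h \<Rightarrow> 'y \<Rightarrow> real"
    and \<eta> :: "'w \<Rightarrow> 'h"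
    and \<Theta> :: "'w \<Rightarrow> enat"
    and X :: "nat \<Rightarrow> 'w \<Rightarrow> nat"
    and Y :: "nat \<Rightarrow> 'w \<Rightarrow> 'y"
  assumes K_ge: "2 \<le> K"
    and sets_mu: "sets \<mu> = sets borel"
    and p0_range: "\<And>h. 0 \<le> p0 h \<and> p0 h < 1"
    and p0_meas: "p0 \<in> borel_measurable borel"
    and p_range: "\<And>t h xs. 1 \<le> t \<Longrightarrow> length xs = t \<Longrightarrow> set xs \<subseteq> {1..K} \<Longrightarrow>
                    0 \<le> p t h xs \<and> p t h xs < 1"
    and p_meas: "\<And>t xs. 1 \<le> t \<Longrightarrow> length xs = t \<Longrightarrow> set xs \<subseteq> {1..K} \<Longrightarrow>
                    (\<lambda>h. p t h xs) \<in> borel_measurable borel"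
    and f_nonneg: "\<And>x h y. x \<in> {1..K} \<Longrightarrow> 0 \<le> f x h y"
    and g_nonneg: "\<And>x h y. x \<in> {1..K} \<Longrightarrow> 0 \<le> g x h y"
    and f_meas: "\<And>x. x \<in> {1..K} \<Longrightarrow> (\<lambda>(h, y). f x h y) \<in> borel_measurable (borel \<Otimes>\<^sub>M borel)"
    and g_meas: "\<And>x. x \<in> {1..K} \<Longrightarrow> (\<lambda>(h, y). g x h y) \<in> borel_measurable (borel \<Otimes>\<^sub>M borel)"
    and f_dens: "\<And>x h. x \<in> {1..K} \<Longrightarrow> (\<integral>\<^sup>+ y. ennreal (f x h y) \<partial>\<mu>) = 1"
    and g_dens: "\<And>x h. x \<in> {1..K} \<Longrightarrow> (\<integral>\<^sup>+ y. ennreal (g x h y) \<partial>\<mu>) = 1"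
    and abs_cont: "\<And>x h. x \<in> {1..K} \<Longrightarrow> AE y in \<mu>. f x h y = 0 \<longrightarrow> g x h y = 0"
    and eta_meas: "\<eta> \<in> M \<rightarrow>\<^sub>M borel"
    and eta_law: "distr M borel \<eta> = prior"
    and Theta_meas: "\<Theta> \<in> M \<rightarrow>\<^sub>M count_space UNIV"
    and Y_meas: "\<And>t. 1 \<le> t \<Longrightarrow> Y t \<in> M \<rightarrow>\<^sub>M borel"
    and rule: "assignment_rule M K X Y"
    and initial:
      "AE \<omega> in M. real_cond_exp M (sigma (space M) (rv_events M borel \<eta>))
                    (indicator {\<omega>\<in>space M. latent \<Theta> 0 \<omega> = 1}) \<omega> = p0 (\<eta> \<omega>)"
    and transition:
      "\<And>t. 1 \<le> t \<Longrightarrow>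
         AE \<omega> in M. latent \<Theta> (t - 1) \<omega> = 0 \<longrightarrow>
           real_cond_exp M
             (sigma (space M) (rv_events M borel \<eta> \<union> obs_events M X Y (t - 1)
                \<union> rv_events M (count_space UNIV) (X t)
                \<union> rv_events M (count_space UNIV) (latent \<Theta> (t - 1))))
             (indicator {\<omega>\<in>space M. latent \<Theta> t \<omega> = 1}) \<omega>
           = trans_prob p (\<lambda>s. X s \<omega>) t (\<eta> \<omega>)"
    and response:
      "\<And>t B. 1 \<le> t \<Longrightarrow> B \<in> sets borel \<Longrightarrow>
         AE \<omega> in M.
           real_cond_exp M
             (sigma (space M) (rv_events M borel \<eta> \<union> obs_events M X Y (t - 1)
                \<union> rv_events M (count_space UNIV) (X t)
                \<union> (\<Union>s\<in>{0..t}. rv_events M (count_space UNIV) (latent \<Theta> s))))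
             (indicator {\<omega>\<in>space M. Y t \<omega> \<in> B}) \<omega>
           = measure (density \<mu> (\<lambda>y. ennreal (if latent \<Theta> t \<omega> = 0
                                                then f (X t \<omega>) (\<eta> \<omega>) y
                                                else g (X t \<omega>) (\<eta> \<omega>) y))) B"

end

theory Submission
  imports Defs
begin

text \<open>
  Since the treatments are functions of the past responses, everything is expressed through \<open>\<eta>\<close> and
  \<open>Y\<^sub>1, \<dots>, Y\<^sub>t\<close>.  By induction on \<open>t\<close>, the law of \<open>(\<eta>, Y\<^sub>1, \<dots>, Y\<^sub>t)\<close> restricted to \<open>{L\<^sub>t = 0}\<close> has
  density \<open>D\<^sub>t\<close> with respect to the product of the prior and \<open>\<mu>\<^sup>t\<close>, and its restriction to
  \<open>{L\<^sub>t = 1}\<close> has density \<open>D\<^sub>t \<Gamma>\<^sub>t\<close>: the transition law splits the mass on \<open>{L\<^sub>t = 0}\<close>, and the response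
  law multiplies by \<open>f\<close> or \<open>g\<close>.  Hence \<open>D\<^sub>t (1 + \<Gamma>\<^sub>t)\<close> is the joint density of \<open>(\<eta>, Y\<^sub>1, \<dots>, Y\<^sub>t)\<close>, and
  Bayes' formula gives the posterior.
\<close>

section \<open>Conditional expectations and conditional densities\<close>

text \<open>The hypotheses prescribe conditional probabilities of single events, each with its own
  null set, whereas a density formula concerns a whole joint law. Each hypothesis is therefore
  turned into an identity between \<open>ennreal\<close> integrals of an arbitrary measurable test
  function: such integrals always exist, and Tonelli's theorem moves mass freely between parameter,
  past responses and new response. The response law takes the most work, because the test function
  couples the new response with the history.

  Integrals against \<mu>^t also range over response vectors that no outcome produces. The
  treatments must therefore be extended to measurable maps on all response vectors, with values in
  \<open>{1..K}\<close>, before the densities can be integrated.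

  The quotient in Bayes' formula may have a degenerate denominator. If it is 0, then the numerator
  is 0 as well; it is infinite only on a \<mu>^t-null set.\<close>

lemma rv_events_subset:
  assumes "Z \<in> M \<rightarrow>\<^sub>M N"
  shows "rv_events M N Z \<subseteq> sets M"
  unfolding rv_events_def using assms
  by (subst sets_vimage_algebra2) (auto simp: measurable_space intro: measurable_sets)

lemma measurable_sigma_rv_events:
  assumes "Z \<in> space M \<rightarrow> space N" "rv_events M N Z \<subseteq> E" "E \<subseteq> sets M"
  shows "Z \<in> sigma (space M) E \<rightarrow>\<^sub>M N"
proof (rule measurableI)
  have "E \<subseteq> Pow (space M)"
    using assms(3) sets.sets_into_space by blast
  fix A assume "A \<in> sets N"
  then have "Z -` A \<inter> space M \<in> E"
    using assms(2) in_vimage_algebra[of A N Z "space M"] by (auto simp: rv_events_def)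
  then show "Z -` A \<inter> space (sigma (space M) E) \<in> sets (sigma (space M) E)"
    using \<open>E \<subseteq> Pow (space M)\<close> by (simp add: space_measure_of_conv)
qed (use assms in \<open>auto simp: space_measure_of_conv\<close>)

lemma subalgebra_sigma:
  assumes "E \<subseteq> sets M"
  shows "subalgebra M (sigma (space M) E)"
proof -
  have "E \<subseteq> Pow (space M)"
    using assms sets.sets_into_space by blast
  then show ?thesis
    using sets.sigma_sets_subset[OF assms] by (simp add: subalgebra_def space_measure_of_conv)
qed

text \<open>Lists over a countable alphabet are countable, so the tail can be fixed at one of
  countably many values while the head is added. This serves \<open>p\<close>, which takes the
  treatment history as a list.\<close>

lemma measurable_map_count_space:
  fixes x :: "'i \<Rightarrow> 'a \<Rightarrow> 'b"
  assumes "countable A" "\<And>i. i \<in> set js \<Longrightarrow> x i \<in> M \<rightarrow>\<^sub>M count_space A"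
  shows "(\<lambda>y. map (\<lambda>i. x i y) js) \<in> M \<rightarrow>\<^sub>M count_space {xs. length xs = length js \<and> set xs \<subseteq> A}"
  using assms(2)
proof (induction js)
  case Nil
  then show ?case by simp
next
  case (Cons j js)
  let ?L = "{xs. length xs = length js \<and> set xs \<subseteq> A}"
  have "countable ?L"
    by (rule countable_subset[OF _ countable_lists[OF assms(1)]]) auto
  moreover have "(\<lambda>y. map (\<lambda>i. x i y) js) \<in> M \<rightarrow>\<^sub>M count_space ?L"
    using Cons by simp
  moreover have "(\<lambda>y. x j y # l) \<in> M \<rightarrow>\<^sub>M count_space {xs. length xs = length (j # js) \<and> set xs \<subseteq> A}"
    if "l \<in> ?L" for l
    using that by (intro measurable_compose[OF Cons.prems[of j]]) auto
  ultimately show ?case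
    using measurable_compose_countable'[of ?L "\<lambda>l y. x j y # l" M _ "\<lambda>y. map (\<lambda>i. x i y) js"]
    by simp
qed

text \<open>Passing through the product measure makes additivity a single application, with joint
  measurability as the only obligation.\<close>

lemma (in sigma_finite_measure) nn_integral_iterated_add:
  assumes a[measurable]: "a \<in> borel_measurable (N \<Otimes>\<^sub>M M)" and b[measurable]: "b \<in> borel_measurable (N \<Otimes>\<^sub>M M)"
  shows "(\<integral>\<^sup>+ x. \<integral>\<^sup>+ y. a (x, y) \<partial>M \<partial>N) + (\<integral>\<^sup>+ x. \<integral>\<^sup>+ y. b (x, y) \<partial>M \<partial>N) =
    (\<integral>\<^sup>+ x. \<integral>\<^sup>+ y. a (x, y) + b (x, y) \<partial>M \<partial>N)"
proof -
  have "(\<integral>\<^sup>+ x. \<integral>\<^sup>+ y. a (x, y) + b (x, y) \<partial>M \<partial>N) = (\<integral>\<^sup>+ z. a z + b z \<partial>(N \<Otimes>\<^sub>M M))"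
    by (rule nn_integral_fst) measurable
  then show ?thesis
    by (simp add: nn_integral_fst[OF a] nn_integral_fst[OF b] nn_integral_add)
qed

section \<open>Conditional probabilities as integral identities\<close>

context prob_space
begin

text \<open>\<open>real_cond_exp\<close> is a difference of two \<open>enn2real\<close> values, and
  \<open>enn2real\<close> loses information only at infinity. Comparison with the constant 1
  excludes infinity, and the negative part of an indicator is 0.\<close>

lemma ennreal_real_cond_exp_indicator:
  assumes "subalgebra M S" and [measurable]: "A \<in> sets M"
  shows "AE \<omega> in M. ennreal (real_cond_exp M S (indicator A) \<omega>) = nn_cond_exp M S (indicator A) \<omega>"
proof -
  interpret finite_measure_subalgebra M S
    by standard fact
  have 0: "AE \<omega> in M. 0 = nn_cond_exp M S (\<lambda>\<omega>. 0) \<omega>"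
    by (rule nn_cond_exp_F_meas) simp
  have 1: "AE \<omega> in M. 1 = nn_cond_exp M S (\<lambda>\<omega>. 1) \<omega>"
    by (rule nn_cond_exp_F_meas) simp
  have le: "AE \<omega> in M. nn_cond_exp M S (indicator A) \<omega> \<le> nn_cond_exp M S (\<lambda>\<omega>. 1) \<omega>"
    by (rule nn_cond_exp_mono) (auto simp: indicator_def)
  have eq: "(\<lambda>\<omega>. ennreal (indicator A \<omega>)) = indicator A" "(\<lambda>\<omega>. ennreal (- indicator A \<omega>)) = (\<lambda>\<omega>. 0)"
    by (auto simp: indicator_def fun_eq_iff ennreal_neg)
  show ?thesis
    using 0 1 le
  proof eventually_elim
    case (elim \<omega>)
    then have "nn_cond_exp M S (indicator A) \<omega> < top"
      by (metis ennreal_one_less_top order_le_less_trans)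
    with elim(1) show ?case
      by (simp add: real_cond_exp_def eq)
  qed
qed

text \<open>This is the defining property of conditional expectation with an
  \<open>S\<close>-measurable weight. Asking for \<open>u\<close> only where \<open>W\<close> is
  nonzero fits \<open>transition\<close>, which speaks only of outcomes not yet changed.\<close>

lemma nn_integral_indicator_eq_cond_exp:
  assumes S: "subalgebra M S" and A: "A \<in> sets M"
    and W: "W \<in> borel_measurable S"
    and u: "AE \<omega> in M. W \<omega> \<noteq> 0 \<longrightarrow> real_cond_exp M S (indicator A) \<omega> = u \<omega>"
  shows "(\<integral>\<^sup>+ \<omega>. W \<omega> * indicator A \<omega> \<partial>M) = (\<integral>\<^sup>+ \<omega>. W \<omega> * ennreal (u \<omega>) \<partial>M)"
proof -
  interpret finite_measure_subalgebra M S
    by standard fact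
  have "(\<integral>\<^sup>+ \<omega>. W \<omega> * indicator A \<omega> \<partial>M) = (\<integral>\<^sup>+ \<omega>. W \<omega> * nn_cond_exp M S (indicator A) \<omega> \<partial>M)"
    using A W by (intro nn_cond_exp_intg[symmetric]) auto
  also have "\<dots> = (\<integral>\<^sup>+ \<omega>. W \<omega> * ennreal (u \<omega>) \<partial>M)"
  proof (rule nn_integral_cong_AE)
    show "AE \<omega> in M. W \<omega> * nn_cond_exp M S (indicator A) \<omega> = W \<omega> * ennreal (u \<omega>)"
      using u ennreal_real_cond_exp_indicator[OF S A]
      by eventually_elim (metis mult_zero_left)
  qed
  finally show ?thesis .
qed

text \<open>The model specifies the probability that the change has occurred; the
  \<open>latent = 0\<close> branch needs the complementary one.\<close>

lemma real_cond_exp_indicator_compl: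
  assumes S: "subalgebra M S" and A[measurable]: "A \<in> sets M"
  shows "AE \<omega> in M. real_cond_exp M S (indicator (space M - A)) \<omega> = 1 - real_cond_exp M S (indicator A) \<omega>"
proof -
  interpret finite_measure_subalgebra M S
    by standard fact
  have int: "integrable M (indicator A :: 'a \<Rightarrow> real)"
    by (simp add: less_top[symmetric])
  have 1: "AE \<omega> in M. real_cond_exp M S (\<lambda>\<omega>. 1) \<omega> = 1"
    by (rule real_cond_exp_F_meas) auto
  have d: "AE \<omega> in M. real_cond_exp M S (\<lambda>\<omega>. 1 - indicator A \<omega>) \<omega>
      = real_cond_exp M S (\<lambda>\<omega>. 1) \<omega> - real_cond_exp M S (indicator A) \<omega>"
    using int by (intro real_cond_exp_diff) auto
  have "AE \<omega> in M. real_cond_exp M S (indicator (space M - A)) \<omega>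
      = real_cond_exp M S (\<lambda>\<omega>. 1 - indicator A \<omega>) \<omega>"
    by (intro real_cond_exp_cong AE_I2) (auto simp: indicator_def)
  with 1 d show ?thesis
    by eventually_elim simp
qed

text \<open>The null set in \<open>cond\<close> depends on \<open>B\<close>, so \<open>k\<close>
  cannot simply be substituted pointwise as a conditional law. Both sides are instead read as
  integrals of \<open>F\<close> against finite measures on the product space, which agree on
  rectangles and hence everywhere.\<close>

lemma nn_integral_conditional_density:
  assumes S: "subalgebra M S" and \<mu>: "sigma_finite_measure \<mu>" and sets_\<mu>: "sets \<mu> = sets N'"
    and Z: "Z \<in> S \<rightarrow>\<^sub>M N" and E: "E \<in> sets S" and Y[measurable]: "Y \<in> M \<rightarrow>\<^sub>M N'"
    and k: "(\<lambda>(\<omega>, y). k \<omega> y) \<in> borel_measurable (M \<Otimes>\<^sub>M \<mu>)"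
    and k_int: "\<And>\<omega>. \<omega> \<in> space M \<Longrightarrow> (\<integral>\<^sup>+ y. k \<omega> y \<partial>\<mu>) = 1"
    and cond: "\<And>B. B \<in> sets N' \<Longrightarrow> AE \<omega> in M.
      real_cond_exp M S (indicator {\<omega>\<in>space M. Y \<omega> \<in> B}) \<omega> = measure (density \<mu> (k \<omega>)) B"
    and F: "(\<lambda>(z, y). F z y) \<in> borel_measurable (N \<Otimes>\<^sub>M N')"
  shows "(\<integral>\<^sup>+ \<omega>. F (Z \<omega>) (Y \<omega>) * indicator E \<omega> \<partial>M) =
    (\<integral>\<^sup>+ \<omega>. (\<integral>\<^sup>+ y. F (Z \<omega>) y * k \<omega> y \<partial>\<mu>) * indicator E \<omega> \<partial>M)"
proof -
  interpret \<mu>: sigma_finite_measure \<mu> by fact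
  have ZM[measurable]: "Z \<in> M \<rightarrow>\<^sub>M N"
    by (rule measurable_from_subalg[OF S Z])
  have EM[measurable]: "E \<in> sets M"
    using S E by (auto simp: subalgebra_def)
  note [measurable_cong] = sets_\<mu>
  note [measurable] = k F
  \<comment> \<open>\<open>m1\<close> is the law of the pair \<open>(Z, Y)\<close> on
    \<open>E\<close>; \<open>m2\<close> is the same law with \<open>Y\<close> redrawn from the
    density \<open>k \<omega>\<close>.\<close>
  define m1 where "m1 = distr (density M (indicator E)) (N \<Otimes>\<^sub>M N') (\<lambda>\<omega>. (Z \<omega>, Y \<omega>))"
  define m2 where "m2 = distr (density (M \<Otimes>\<^sub>M \<mu>) (\<lambda>(\<omega>, y). indicator E \<omega> * k \<omega> y))
    (N \<Otimes>\<^sub>M N') (\<lambda>(\<omega>, y). (Z \<omega>, y))"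
  have m1: "(\<integral>\<^sup>+ x. G x \<partial>m1) = (\<integral>\<^sup>+ \<omega>. indicator E \<omega> * G (Z \<omega>, Y \<omega>) \<partial>M)"
    if [measurable]: "G \<in> borel_measurable (N \<Otimes>\<^sub>M N')" for G
    unfolding m1_def by (simp add: nn_integral_distr nn_integral_density)
  have m2: "(\<integral>\<^sup>+ x. G x \<partial>m2) = (\<integral>\<^sup>+ \<omega>. indicator E \<omega> * (\<integral>\<^sup>+ y. k \<omega> y * G (Z \<omega>, y) \<partial>\<mu>) \<partial>M)"
    if [measurable]: "G \<in> borel_measurable (N \<Otimes>\<^sub>M N')" for G
  proof -
    have "(\<integral>\<^sup>+ x. G x \<partial>m2) = (\<integral>\<^sup>+ x. (case x of (\<omega>, y) \<Rightarrow> indicator E \<omega> * k \<omega> y) *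
        G (case x of (\<omega>, y) \<Rightarrow> (Z \<omega>, y)) \<partial>(M \<Otimes>\<^sub>M \<mu>))"
      unfolding m2_def by (subst nn_integral_distr) (auto simp: nn_integral_density)
    also have "\<dots> = (\<integral>\<^sup>+ \<omega>. \<integral>\<^sup>+ y. indicator E \<omega> * k \<omega> y * G (Z \<omega>, y) \<partial>\<mu> \<partial>M)"
      by (subst \<mu>.nn_integral_fst[symmetric]) auto
    also have "\<dots> = (\<integral>\<^sup>+ \<omega>. indicator E \<omega> * (\<integral>\<^sup>+ y. k \<omega> y * G (Z \<omega>, y) \<partial>\<mu>) \<partial>M)"
      by (intro nn_integral_cong) (simp add: mult.assoc nn_integral_cmult)
    finally show ?thesis .
  qed
  have "m1 = m2"
  proof (rule measure_eqI_generator_eq)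
    show "Int_stable {a \<times> b |a b. a \<in> sets N \<and> b \<in> sets N'}"
      by (rule Int_stable_pair_measure_generator)
    show "{a \<times> b |a b. a \<in> sets N \<and> b \<in> sets N'} \<subseteq> Pow (space N \<times> space N')"
      by (rule pair_measure_closed)
    show "sets m1 = sigma_sets (space N \<times> space N') {a \<times> b |a b. a \<in> sets N \<and> b \<in> sets N'}"
      by (simp add: m1_def sets_pair_measure)
    show "sets m2 = sigma_sets (space N \<times> space N') {a \<times> b |a b. a \<in> sets N \<and> b \<in> sets N'}"
      by (simp add: m2_def sets_pair_measure)
    show "range (\<lambda>i::nat. space N \<times> space N') \<subseteq> {a \<times> b |a b. a \<in> sets N \<and> b \<in> sets N'}"
      by auto
    show "emeasure m1 (space N \<times> space N') \<noteq> \<infinity>"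
    proof -
      have "emeasure m1 (space N \<times> space N') = (\<integral>\<^sup>+ x. indicator (space N \<times> space N') x \<partial>m1)"
        by (subst nn_integral_indicator) (auto simp: m1_def)
      also have "\<dots> \<le> (\<integral>\<^sup>+ \<omega>. 1 \<partial>M)"
        by (subst m1, simp, intro nn_integral_mono) (auto simp: indicator_def)
      finally have "emeasure m1 (space N \<times> space N') \<le> 1"
        by (simp add: emeasure_space_1)
      then show ?thesis
        by (metis ennreal_one_neq_top infinity_ennreal_def top.extremum_uniqueI)
    qed
  next
    fix R assume "R \<in> {a \<times> b |a b. a \<in> sets N \<and> b \<in> sets N'}"
    then obtain A B where R: "R = A \<times> B" and [measurable]: "A \<in> sets N" "B \<in> sets N'"
      by auto
    have ind: "(\<lambda>x. indicator R x :: ennreal) = (\<lambda>x. indicator A (fst x) * indicator B (snd x))"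
      by (auto simp: R indicator_def fun_eq_iff)
    have [measurable]: "R \<in> sets (N \<Otimes>\<^sub>M N')"
      by (simp add: R)
    have "emeasure m1 R = (\<integral>\<^sup>+ x. indicator R x \<partial>m1)"
      by (subst nn_integral_indicator) (auto simp: m1_def)
    also have "\<dots> = (\<integral>\<^sup>+ \<omega>. (indicator E \<omega> * indicator A (Z \<omega>)) * indicator {\<omega>\<in>space M. Y \<omega> \<in> B} \<omega> \<partial>M)"
      by (subst m1) (auto simp: ind indicator_def intro!: nn_integral_cong)
    \<comment> \<open>On a rectangle the factor involving \<open>E\<close> and \<open>Z\<close> is
      \<open>S\<close>-measurable, so only the single event \<open>Y \<in> B\<close> is conditioned
      on.\<close>
    also have "\<dots> = (\<integral>\<^sup>+ \<omega>. (indicator E \<omega> * indicator A (Z \<omega>)) * ennreal (measure (density \<mu> (k \<omega>)) B) \<partial>M)"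
      using E Z by (intro nn_integral_indicator_eq_cond_exp[OF S])
        (auto intro: eventually_mono[OF cond[of B]])
    also have "\<dots> = (\<integral>\<^sup>+ \<omega>. indicator E \<omega> * (\<integral>\<^sup>+ y. k \<omega> y * indicator R (Z \<omega>, y) \<partial>\<mu>) \<partial>M)"
    proof (intro nn_integral_cong)
      fix \<omega> assume \<omega>[measurable]: "\<omega> \<in> space M"
      \<comment> \<open>\<open>measure\<close> would turn infinite mass into 0; total mass 1 allows
        the return to the integral of \<open>k \<omega>\<close>.\<close>
      then have "prob_space (density \<mu> (k \<omega>))"
        using k_int[OF \<omega>] by (intro prob_spaceI) (simp add: emeasure_density cong: nn_integral_cong)
      then interpret D: prob_space "density \<mu> (k \<omega>)" .
      have "ennreal (measure (density \<mu> (k \<omega>)) B) = (\<integral>\<^sup>+ y. k \<omega> y * indicator B y \<partial>\<mu>)"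
        by (simp add: D.emeasure_eq_measure[symmetric] emeasure_density)
      then show "indicator E \<omega> * indicator A (Z \<omega>) * ennreal (measure (density \<mu> (k \<omega>)) B) =
          indicator E \<omega> * (\<integral>\<^sup>+ y. k \<omega> y * indicator R (Z \<omega>, y) \<partial>\<mu>)"
        by (auto simp: indicator_def R intro!: nn_integral_cong split: if_splits)
    qed
    also have "\<dots> = (\<integral>\<^sup>+ x. indicator R x \<partial>m2)"
      by (subst m2) auto
    also have "\<dots> = emeasure m2 R"
      by (subst nn_integral_indicator) (auto simp: m2_def)
    finally show "emeasure m1 R = emeasure m2 R" .
  qed auto
  with m1[OF F] m2[OF F] show ?thesis
    by (simp add: mult.commute)
qed

end

section \<open>Treatments as functions of past responses\<close>

text \<open>This and the next two congruences serve two purposes: replacing observed treatments by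
  functions of the responses, and ignoring a response later than \<open>t\<close>.\<close>

lemma trans_prob_cong:
  assumes "\<And>s. 1 \<le> s \<Longrightarrow> s \<le> t \<Longrightarrow> x s = x' s"
  shows "trans_prob p x t h = trans_prob p x' t h"
proof -
  have "map x [1..<Suc t] = map x' [1..<Suc t]"
    using assms by (intro map_cong) auto
  then show ?thesis by (simp only: trans_prob_def)
qed

lemma no_change_dens_cong:
  assumes "\<And>s. 1 \<le> s \<Longrightarrow> s \<le> t \<Longrightarrow> x s = x' s" "\<And>s. 1 \<le> s \<Longrightarrow> s \<le> t \<Longrightarrow> y s = y' s"
  shows "no_change_dens p0 p f x y t h = no_change_dens p0 p f x' y' t h"
proof -
  have "trans_prob p x s h = trans_prob p x' s h" if "s \<le> t" for s
    using that assms by (intro trans_prob_cong) auto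
  then show ?thesis
    using assms by (auto simp: no_change_dens_def intro!: arg_cong2[where f="(*)"] prod.cong)
qed

lemma post_odds_cong:
  assumes "\<And>s. 1 \<le> s \<Longrightarrow> s \<le> t \<Longrightarrow> x s = x' s" "\<And>s. 1 \<le> s \<Longrightarrow> s \<le> t \<Longrightarrow> y s = y' s"
  shows "post_odds p0 p f g x y t h = post_odds p0 p f g x' y' t h"
  using assms
proof (induction t)
  case (Suc t)
  have "trans_prob p x (Suc t) h = trans_prob p x' (Suc t) h"
    using Suc.prems by (intro trans_prob_cong) auto
  moreover have "post_odds p0 p f g x y t h = post_odds p0 p f g x' y' t h"
    using Suc.prems by (intro Suc.IH) auto
  moreover have "lik_ratio f g x y (Suc t) h = lik_ratio f g x' y' (Suc t) h"
    using Suc.prems by (simp add: lik_ratio_def)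
  ultimately show ?case
    by simp
qed simp

lemma no_change_dens_Suc:
  "no_change_dens p0 p f x y (Suc t) h =
    no_change_dens p0 p f x y t h * ((1 - trans_prob p x (Suc t) h) * f (x (Suc t)) h (y (Suc t)))"
  by (simp add: no_change_dens_def)

context change_point_model
begin

text \<open>Strong induction: the rule at \<open>t\<close> takes all earlier treatments as
  arguments, and each of these is already a measurable function of still earlier responses, so
  substitution eliminates them.\<close>

lemma treatment_from_responses:
  assumes "1 \<le> t"
  shows "\<exists>\<psi> \<in> PiM {1..<t} (\<lambda>_. borel) \<rightarrow>\<^sub>M count_space {1..K}.
    \<forall>\<omega>\<in>space M. X t \<omega> = \<psi> (\<lambda>s\<in>{1..<t}. Y s \<omega>)"
  using assms
proof (induction t rule: less_induct)
  case (less t)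
  show ?case
  proof (cases "t = 1")
    case True
    from rule obtain x where "x \<in> {1..K}" "\<forall>\<omega>\<in>space M. X 1 \<omega> = x"
      unfolding assignment_rule_def by blast
    with True show ?thesis
      by (intro bexI[of _ "\<lambda>_. x"]) auto
  next
    case False
    with less.prems have "2 \<le> t" by simp
    then obtain \<phi> where \<phi>[measurable]: "\<phi> \<in> (PiM {1..<t} (\<lambda>_. count_space {1..K}) \<Otimes>\<^sub>M PiM {1..<t} (\<lambda>_. borel))
        \<rightarrow>\<^sub>M count_space {1..K}"
      and X: "\<And>\<omega>. \<omega> \<in> space M \<Longrightarrow> X t \<omega> = \<phi> (\<lambda>s\<in>{1..<t}. X s \<omega>, \<lambda>s\<in>{1..<t}. Y s \<omega>)"
      using rule unfolding assignment_rule_def by blast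
    have "\<forall>s\<in>{1..<t}. \<exists>\<psi>. \<psi> \<in> PiM {1..<s} (\<lambda>_. borel) \<rightarrow>\<^sub>M count_space {1..K} \<and>
        (\<forall>\<omega>\<in>space M. X s \<omega> = \<psi> (\<lambda>r\<in>{1..<s}. Y r \<omega>))"
      proof
      fix s assume "s \<in> {1..<t}"
      then show "\<exists>\<psi>. \<psi> \<in> PiM {1..<s} (\<lambda>_. borel) \<rightarrow>\<^sub>M count_space {1..K} \<and>
          (\<forall>\<omega>\<in>space M. X s \<omega> = \<psi> (\<lambda>r\<in>{1..<s}. Y r \<omega>))"
        using less.IH[of s] unfolding Bex_def by simp
    qed
    \<comment> \<open>One map per earlier time is chosen at once, so that the vector of earlier
      treatments becomes a single measurable map of the responses.\<close>
    from bchoice[OF this] obtain \<psi> where \<psi>: "\<And>s. s \<in> {1..<t} \<Longrightarrow> \<psi> s \<in> PiM {1..<s} (\<lambda>_. borel) \<rightarrow>\<^sub>M count_space {1..K}"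
        "\<And>s \<omega>. s \<in> {1..<t} \<Longrightarrow> \<omega> \<in> space M \<Longrightarrow> X s \<omega> = \<psi> s (\<lambda>r\<in>{1..<s}. Y r \<omega>)"
      by blast
    have \<psi>_meas: "(\<lambda>y. \<psi> s (restrict y {1..<s})) \<in> PiM {1..<t} (\<lambda>_. borel) \<rightarrow>\<^sub>M count_space {1..K}"
      if "s \<in> {1..<t}" for s
      using that by (intro measurable_compose[OF measurable_restrict_subset \<psi>(1)]) auto
    have "restrict (\<lambda>s\<in>{1..<t}. Y s \<omega>) {1..<s} = (\<lambda>r\<in>{1..<s}. Y r \<omega>)" if "s \<in> {1..<t}" for s \<omega>
      using that by (auto simp: fun_eq_iff)
    then have "X t \<omega> = \<phi> (\<lambda>s\<in>{1..<t}. \<psi> s (restrict (\<lambda>s\<in>{1..<t}. Y s \<omega>) {1..<s}), \<lambda>s\<in>{1..<t}. Y s \<omega>)"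
      if "\<omega> \<in> space M" for \<omega>
      using that X[OF that] \<psi>(2) by (simp cong: restrict_cong)
    moreover have "(\<lambda>y. \<phi> (\<lambda>s\<in>{1..<t}. \<psi> s (restrict y {1..<s}), y)) \<in>
        PiM {1..<t} (\<lambda>_. borel) \<rightarrow>\<^sub>M count_space {1..K}"
      by (rule measurable_compose[OF measurable_Pair \<phi>])
        (rule measurable_restrict, erule \<psi>_meas, rule measurable_ident[unfolded id_def])
    ultimately show ?thesis
      by (intro bexI[of _ "\<lambda>y. \<phi> (\<lambda>s\<in>{1..<t}. \<psi> s (restrict y {1..<s}), y)"] ballI)
  qed
qed

text \<open>Maps as in the preceding lemma agree on response vectors that occur but may differ on
  the others, and the densities are integrated over all of them. One version is fixed here once and
  for all.\<close>

definition treatment_map :: "nat \<Rightarrow> (nat \<Rightarrow> 'y) \<Rightarrow> nat" where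
  "treatment_map t = (SOME \<psi>. \<psi> \<in> PiM {1..<t} (\<lambda>_. borel) \<rightarrow>\<^sub>M count_space {1..K} \<and>
    (\<forall>\<omega>\<in>space M. X t \<omega> = \<psi> (\<lambda>s\<in>{1..<t}. Y s \<omega>)))"

definition treatment :: "(nat \<Rightarrow> 'y) \<Rightarrow> nat \<Rightarrow> nat" where
  "treatment y t = treatment_map t (restrict y {1..<t})"

lemma treatment_map:
  assumes "1 \<le> t"
  shows "treatment_map t \<in> PiM {1..<t} (\<lambda>_. borel) \<rightarrow>\<^sub>M count_space {1..K}"
    and "\<omega> \<in> space M \<Longrightarrow> X t \<omega> = treatment_map t (\<lambda>s\<in>{1..<t}. Y s \<omega>)"
proof -
  have "\<exists>\<psi>. \<psi> \<in> PiM {1..<t} (\<lambda>_. borel) \<rightarrow>\<^sub>M count_space {1..K} \<and>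
    (\<forall>\<omega>\<in>space M. X t \<omega> = \<psi> (\<lambda>s\<in>{1..<t}. Y s \<omega>))"
    using treatment_from_responses[OF assms] by blast
  from someI_ex[OF this]
  show "treatment_map t \<in> PiM {1..<t} (\<lambda>_. borel) \<rightarrow>\<^sub>M count_space {1..K}"
    and "\<omega> \<in> space M \<Longrightarrow> X t \<omega> = treatment_map t (\<lambda>s\<in>{1..<t}. Y s \<omega>)"
    by (auto simp: treatment_map_def)
qed

lemma measurable_treatment:
  assumes "1 \<le> s" "s \<le> Suc t"
  shows "(\<lambda>y. treatment y s) \<in> PiM {1..t} (\<lambda>_. borel) \<rightarrow>\<^sub>M count_space {1..K}"
  unfolding treatment_def using assms
  by (intro measurable_compose[OF measurable_restrict_subset treatment_map(1)]) auto

text \<open>Valid for every sequence, whether or not an outcome produces it, so the hypotheses on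
  \<open>f\<close>, \<open>g\<close> and \<open>p\<close> apply throughout the product
  space.\<close>

lemma treatment_range: "1 \<le> s \<Longrightarrow> treatment y s \<in> {1..K}"
  using measurable_space[OF treatment_map(1)[of s], of "restrict y {1..<s}"]
  by (auto simp: treatment_def space_PiM)

text \<open>The bound is \<open>Suc t\<close> because the treatment at \<open>s\<close> reads
  responses strictly before \<open>s\<close>: the first \<open>t\<close> responses already determine
  the next treatment.\<close>

lemma treatment_restrict: "s \<le> Suc t \<Longrightarrow> treatment (restrict y {1..t}) s = treatment y s"
  unfolding treatment_def by (intro arg_cong[where f="treatment_map s"]) (auto simp: fun_eq_iff)

lemma treatment_upd: "s \<le> t \<Longrightarrow> treatment (y(t := v)) s = treatment y s"
  unfolding treatment_def by (intro arg_cong[where f="treatment_map s"]) (auto simp: fun_eq_iff)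

lemma X_eq_treatment:
  assumes "\<omega> \<in> space M" "1 \<le> s"
  shows "X s \<omega> = treatment (\<lambda>r. Y r \<omega>) s"
  using treatment_map(2)[OF assms(2,1)] by (simp add: treatment_def)

lemma X_range: "\<omega> \<in> space M \<Longrightarrow> 1 \<le> s \<Longrightarrow> X s \<omega> \<in> {1..K}"
  using treatment_range by (simp add: X_eq_treatment)

abbreviation responses :: "nat \<Rightarrow> 'w \<Rightarrow> nat \<Rightarrow> 'y" where
  "responses t \<omega> \<equiv> (\<lambda>s\<in>{1..t}. Y s \<omega>)"

abbreviation response_space :: "nat \<Rightarrow> (nat \<Rightarrow> 'y) measure" where
  "response_space t \<equiv> PiM {1..t} (\<lambda>_. borel)"

lemma measurable_responses [measurable]: "responses t \<in> M \<rightarrow>\<^sub>M response_space t"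
  using Y_meas by (intro measurable_restrict) auto

lemma X_eq_treatment_responses:
  "\<omega> \<in> space M \<Longrightarrow> 1 \<le> s \<Longrightarrow> s \<le> Suc t \<Longrightarrow> X s \<omega> = treatment (responses t \<omega>) s"
  by (simp add: X_eq_treatment treatment_restrict[unfolded One_nat_def])

lemma measurable_X:
  assumes "1 \<le> s"
  shows "X s \<in> M \<rightarrow>\<^sub>M count_space {1..K}"
proof -
  have "(\<lambda>\<omega>. treatment (responses s \<omega>) s) \<in> M \<rightarrow>\<^sub>M count_space {1..K}"
    using assms by (intro measurable_compose[OF measurable_responses measurable_treatment]) auto
  then show ?thesis
    by (rule measurable_cong[THEN iffD1, rotated]) (rule X_eq_treatment_responses[OF _ assms, symmetric], auto)
qed

lemma measurable_X_UNIV: "1 \<le> s \<Longrightarrow> X s \<in> M \<rightarrow>\<^sub>M count_space UNIV"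
  by (rule measurable_compose[OF measurable_X]) auto

lemma measurable_latent [measurable]: "latent \<Theta> t \<in> M \<rightarrow>\<^sub>M count_space UNIV"
  unfolding latent_def[abs_def] by (rule measurable_compose[OF Theta_meas]) simp

lemma sets_prior [measurable_cong]: "sets prior = sets borel"
  by (simp flip: eta_law)

lemma prob_space_prior: "prob_space prior"
  unfolding eta_law[symmetric] by (rule prob_space_distr) (rule eta_meas)

lemma product_sigma_finite_mu: "product_sigma_finite (\<lambda>_::nat. \<mu>)"
  by standard (rule resp.sigma_finite_countable)

lemma sets_PiM_mu [measurable_cong]: "sets (PiM {1..t} (\<lambda>_. \<mu>)) = sets (response_space t)"
  by (intro sets_PiM_cong) (auto simp: sets_mu)

section \<open>Model quantities as functions of the parameter and the responses\<close>

abbreviation tp :: "nat \<Rightarrow> 'h \<Rightarrow> (nat \<Rightarrow> 'y) \<Rightarrow> real" where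
  "tp t h y \<equiv> trans_prob p (treatment y) t h"

abbreviation dens :: "nat \<Rightarrow> 'h \<Rightarrow> (nat \<Rightarrow> 'y) \<Rightarrow> real" where
  "dens t h y \<equiv> no_change_dens p0 p f (treatment y) y t h"

abbreviation odds :: "nat \<Rightarrow> 'h \<Rightarrow> (nat \<Rightarrow> 'y) \<Rightarrow> real" where
  "odds t h y \<equiv> post_odds p0 p f g (treatment y) y t h"

lemma tp_range:
  assumes "1 \<le> t"
  shows "0 \<le> tp t h y" "tp t h y < 1"
proof -
  have "set (map (treatment y) [1..<Suc t]) \<subseteq> {1..K}"
    using treatment_range by auto
  from p_range[OF assms _ this, of h] show "0 \<le> tp t h y" "tp t h y < 1"
    by (auto simp: trans_prob_def)
qed

lemma dens_nonneg: "0 \<le> dens t h y"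
  unfolding no_change_dens_def
proof (intro mult_nonneg_nonneg prod_nonneg ballI)
  show "0 \<le> 1 - p0 h"
    using p0_range[of h] by simp
  fix s assume "s \<in> {1..t}"
  then show "0 \<le> 1 - tp s h y" "0 \<le> f (treatment y s) h (y s)"
    using tp_range[of s y h] f_nonneg treatment_range[of s y] by auto
qed

lemma odds_nonneg: "0 \<le> odds t h y"
proof (induction t)
  case 0
  then show ?case
    using p0_range[of h] by simp
next
  case (Suc t)
  then show ?case
    using tp_range[of "Suc t" y h] f_nonneg g_nonneg treatment_range[of "Suc t" y]
    by (auto simp: lik_ratio_def intro!: mult_nonneg_nonneg add_nonneg_nonneg divide_nonneg_nonneg)
qed

text \<open>Appending a response at \<open>Suc t\<close> leaves quantities of index \<open>t\<close>
  unchanged. The same holds for \<open>tp (Suc t)\<close>, since the treatments up to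
  \<open>Suc t\<close> read only the first \<open>t\<close> responses.\<close>

lemma dens_upd: "dens t h (y(Suc t := v)) = dens t h y"
  by (intro no_change_dens_cong) (auto simp: treatment_upd)

lemma odds_upd: "odds t h (y(Suc t := v)) = odds t h y"
  by (intro post_odds_cong) (auto simp: treatment_upd)

lemma tp_upd: "tp (Suc t) h (y(Suc t := v)) = tp (Suc t) h y"
  by (intro trans_prob_cong) (auto simp: treatment_upd)

text \<open>\<open>p\<close> is measurable in the parameter for each fixed treatment list. The lists
  that can occur are countable in number, so joint measurability follows by gluing over
  them.\<close>

lemma measurable_tp:
  assumes "1 \<le> s" "s \<le> Suc t"
  shows "(\<lambda>(h, y). tp s h y) \<in> borel_measurable (borel \<Otimes>\<^sub>M response_space t)"
proof -
  let ?L = "{xs. length xs = length [1..<Suc s] \<and> set xs \<subseteq> {1..K}}"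
  have "(\<lambda>z. p s (fst z) (map (\<lambda>r. treatment (snd z) r) [1..<Suc s])) \<in> borel_measurable (borel \<Otimes>\<^sub>M response_space t)"
  proof (rule measurable_compose_countable'[where f="\<lambda>xs z. p s (fst z) xs" and I="?L"])
    show "countable ?L"
      by (rule countable_subset[OF _ countable_lists[of "{1..K}"]]) auto
    show "(\<lambda>z. p s (fst z) xs) \<in> borel_measurable (borel \<Otimes>\<^sub>M response_space t)" if "xs \<in> ?L" for xs
      using that assms by (intro measurable_compose[OF measurable_fst p_meas]) auto
    show "(\<lambda>z. map (\<lambda>r. treatment (snd z) r) [1..<Suc s]) \<in> borel \<Otimes>\<^sub>M response_space t \<rightarrow>\<^sub>M count_space ?L"
      using assms by (intro measurable_map_count_space measurable_compose[OF measurable_snd measurable_treatment]) auto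
  qed
  then show ?thesis
    by (simp add: trans_prob_def split_beta')
qed

text \<open>The same gluing over the finitely many treatments, for a density whose treatment index
  is itself random.\<close>

lemma measurable_response_density:
  assumes q: "\<And>x. x \<in> {1..K} \<Longrightarrow> (\<lambda>(h, v). q x h v) \<in> borel_measurable (borel \<Otimes>\<^sub>M borel)"
    and x: "x \<in> N \<rightarrow>\<^sub>M count_space {1..K}"
    and h: "h \<in> N \<rightarrow>\<^sub>M borel" and v: "v \<in> N \<rightarrow>\<^sub>M borel"
  shows "(\<lambda>z. q (x z) (h z) (v z) :: real) \<in> borel_measurable N"
proof (rule measurable_compose_countable'[OF _ x])
  show "(\<lambda>z. q i (h z) (v z)) \<in> borel_measurable N" if "i \<in> {1..K}" for i
    using measurable_compose[OF measurable_Pair[OF h v] q[OF that]] by simp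
qed auto

lemma measurable_observed_density:
  assumes "\<And>x. x \<in> {1..K} \<Longrightarrow> (\<lambda>(h, v). q x h v) \<in> borel_measurable (borel \<Otimes>\<^sub>M borel)"
    and "1 \<le> s" "s \<le> t"
  shows "(\<lambda>z. q (treatment (snd z) s) (fst z) (snd z s) :: real) \<in> borel_measurable (borel \<Otimes>\<^sub>M response_space t)"
proof (rule measurable_response_density[OF assms(1)])
  show "(\<lambda>z. treatment (snd z) s) \<in> borel \<Otimes>\<^sub>M response_space t \<rightarrow>\<^sub>M count_space {1..K}"
    using assms(2,3) by (intro measurable_compose[OF measurable_snd measurable_treatment]) auto
  show "(\<lambda>z. snd z s) \<in> borel \<Otimes>\<^sub>M response_space t \<rightarrow>\<^sub>M borel"
    using assms(2,3) by (intro measurable_compose[OF measurable_snd measurable_component_singleton]) auto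
qed auto

lemma measurable_dens:
  "(\<lambda>(h, y). dens t h y) \<in> borel_measurable (borel \<Otimes>\<^sub>M response_space t)"
proof -
  have [measurable]: "(\<lambda>z. tp s (fst z) (snd z)) \<in> borel_measurable (borel \<Otimes>\<^sub>M response_space t)"
    "(\<lambda>z. f (treatment (snd z) s) (fst z) (snd z s)) \<in> borel_measurable (borel \<Otimes>\<^sub>M response_space t)"
    if "s \<in> {1..t}" for s
    using that measurable_tp[of s t] measurable_observed_density[OF f_meas, where t=t and s=s]
    by (simp_all add: split_beta')
  note [measurable] = p0_meas
  show ?thesis
    unfolding no_change_dens_def split_beta' by measurable
qed

lemma measurable_odds:
  "s \<le> t \<Longrightarrow> (\<lambda>(h, y). odds s h y) \<in> borel_measurable (borel \<Otimes>\<^sub>M response_space t)"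
proof (induction s)
  case 0
  note [measurable] = p0_meas
  show ?case by simp
next
  case (Suc s)
  have [measurable]: "(\<lambda>z. tp (Suc s) (fst z) (snd z)) \<in> borel_measurable (borel \<Otimes>\<^sub>M response_space t)"
    "(\<lambda>z. odds s (fst z) (snd z)) \<in> borel_measurable (borel \<Otimes>\<^sub>M response_space t)"
    "(\<lambda>z. f (treatment (snd z) (Suc s)) (fst z) (snd z (Suc s))) \<in> borel_measurable (borel \<Otimes>\<^sub>M response_space t)"
    "(\<lambda>z. g (treatment (snd z) (Suc s)) (fst z) (snd z (Suc s))) \<in> borel_measurable (borel \<Otimes>\<^sub>M response_space t)"
    using Suc measurable_tp[of "Suc s" t] measurable_observed_density[OF f_meas, where t=t and s="Suc s"]
      measurable_observed_density[OF g_meas, where t=t and s="Suc s"]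
    by (simp_all add: split_beta')
  show ?case
    unfolding post_odds.simps lik_ratio_def split_beta' by measurable
qed

section \<open>The joint law of the parameter and the responses\<close>

lemma obs_events_subset: "obs_events M X Y t \<subseteq> sets M"
  unfolding obs_events_def
  by (intro UN_least Un_least rv_events_subset) (auto intro: measurable_X_UNIV Y_meas)

text \<open>\<open>E\<close> is left open because several families occur: the observed events alone
  for the posterior, and the two larger families that appear in \<open>transition\<close> and
  \<open>response\<close>.\<close>

lemma measurable_sigma_responses:
  assumes "obs_events M X Y t \<subseteq> E" "E \<subseteq> sets M"
  shows "responses t \<in> sigma (space M) E \<rightarrow>\<^sub>M response_space t"
proof (rule measurable_restrict)
  fix s assume "s \<in> {1..t}"
  then have "rv_events M borel (Y s) \<subseteq> E"
    using assms(1) unfolding obs_events_def by blast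
  then show "Y s \<in> sigma (space M) E \<rightarrow>\<^sub>M borel"
    using assms(2) by (intro measurable_sigma_rv_events) auto
qed

lemma measurable_sigma_history:
  assumes "rv_events M borel \<eta> \<union> obs_events M X Y t \<subseteq> E" "E \<subseteq> sets M"
  shows "(\<lambda>\<omega>. (\<eta> \<omega>, responses t \<omega>)) \<in> sigma (space M) E \<rightarrow>\<^sub>M borel \<Otimes>\<^sub>M response_space t"
proof (rule measurable_Pair)
  show "\<eta> \<in> sigma (space M) E \<rightarrow>\<^sub>M borel"
    using assms by (intro measurable_sigma_rv_events) auto
  show "responses t \<in> sigma (space M) E \<rightarrow>\<^sub>M response_space t"
    using assms by (intro measurable_sigma_responses) auto
qed

abbreviation latent_event :: "nat \<Rightarrow> nat \<Rightarrow> 'w set" where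
  "latent_event t i \<equiv> {\<omega>\<in>space M. latent \<Theta> t \<omega> = i}"

lemma sets_sigma_latent_event:
  assumes "rv_events M (count_space UNIV) (latent \<Theta> t) \<subseteq> E" "E \<subseteq> sets M"
  shows "latent_event t i \<in> sets (sigma (space M) E)"
proof -
  have [measurable]: "latent \<Theta> t \<in> sigma (space M) E \<rightarrow>\<^sub>M count_space UNIV"
    using assms by (intro measurable_sigma_rv_events) auto
  have "{\<omega>\<in>space (sigma (space M) E). latent \<Theta> t \<omega> = i} \<in> sets (sigma (space M) E)"
    by measurable
  then show ?thesis
    by (simp add: space_measure_of_conv)
qed

lemma latent_cases: "latent \<Theta> t \<omega> = 0 \<or> latent \<Theta> t \<omega> = 1"
  by (simp add: latent_def)

lemma latent_Suc_eq_0: "latent \<Theta> (Suc t) \<omega> = 0 \<Longrightarrow> latent \<Theta> t \<omega> = 0"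
proof -
  have "enat t < enat (Suc t)" by simp
  then show "latent \<Theta> (Suc t) \<omega> = 0 \<Longrightarrow> latent \<Theta> t \<omega> = 0"
    unfolding latent_def by (metis less_trans one_neq_zero)
qed

section \<open>One-step identities for the transition and the response\<close>

lemma measurable_history [measurable]:
  "(\<lambda>\<omega>. (\<eta> \<omega>, responses t \<omega>)) \<in> M \<rightarrow>\<^sub>M borel \<Otimes>\<^sub>M response_space t"
  by (rule measurable_Pair[OF eta_meas measurable_responses])

lemma tp_eq_trans_prob:
  assumes "\<omega> \<in> space M"
  shows "trans_prob p (\<lambda>s. X s \<omega>) (Suc t) h = tp (Suc t) h (responses t \<omega>)"
  by (rule trans_prob_cong) (rule X_eq_treatment_responses[OF assms])

text \<open>The changed state is absorbing. Being unchanged at \<open>Suc t\<close> means being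
  unchanged at \<open>t\<close> and not changing now; being changed at \<open>Suc t\<close> means
  being changed already or changing now. The conditional probability is thus used only on
  \<open>latent_event t 0\<close>.\<close>

lemma nn_integral_transition:
  assumes H[measurable]: "H \<in> borel_measurable (borel \<Otimes>\<^sub>M response_space t)"
  shows "(\<integral>\<^sup>+ \<omega>. H (\<eta> \<omega>, responses t \<omega>) * indicator (latent_event (Suc t) 0) \<omega> \<partial>M) =
      (\<integral>\<^sup>+ \<omega>. H (\<eta> \<omega>, responses t \<omega>) * ennreal (1 - tp (Suc t) (\<eta> \<omega>) (responses t \<omega>)) *
        indicator (latent_event t 0) \<omega> \<partial>M)" (is ?unchanged)
    and "(\<integral>\<^sup>+ \<omega>. H (\<eta> \<omega>, responses t \<omega>) * indicator (latent_event (Suc t) 1) \<omega> \<partial>M) =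
      (\<integral>\<^sup>+ \<omega>. H (\<eta> \<omega>, responses t \<omega>) * indicator (latent_event t 1) \<omega> \<partial>M) +
      (\<integral>\<^sup>+ \<omega>. H (\<eta> \<omega>, responses t \<omega>) * ennreal (tp (Suc t) (\<eta> \<omega>) (responses t \<omega>)) *
        indicator (latent_event t 0) \<omega> \<partial>M)" (is ?changed)
proof -
  define E where "E = rv_events M borel \<eta> \<union> obs_events M X Y t \<union>
    rv_events M (count_space UNIV) (X (Suc t)) \<union> rv_events M (count_space UNIV) (latent \<Theta> t)"
  let ?S = "sigma (space M) E"
  let ?A = "latent_event (Suc t) 1"
  let ?W = "\<lambda>\<omega>. H (\<eta> \<omega>, responses t \<omega>) * indicator (latent_event t 0) \<omega>"
  have E: "E \<subseteq> sets M"
    unfolding E_def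
    by (intro Un_least rv_events_subset obs_events_subset) (auto intro: eta_meas measurable_X_UNIV)
  note S = subalgebra_sigma[OF E]
  have [measurable]: "latent_event t 0 \<in> sets ?S"
    using E by (intro sets_sigma_latent_event) (auto simp: E_def)
  have [measurable]: "(\<lambda>\<omega>. (\<eta> \<omega>, responses t \<omega>)) \<in> ?S \<rightarrow>\<^sub>M borel \<Otimes>\<^sub>M response_space t"
    using E by (intro measurable_sigma_history) (auto simp: E_def)
  have W: "?W \<in> borel_measurable ?S"
    by measurable
  have A: "?A \<in> sets M"
    by measurable
  \<comment> \<open>A nonzero weight \<open>?W\<close> forces \<open>latent = 0\<close> at time
    \<open>t\<close>, which is the premise of \<open>transition\<close>.\<close>
  have tr: "AE \<omega> in M. ?W \<omega> \<noteq> 0 \<longrightarrow>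
      real_cond_exp M ?S (indicator ?A) \<omega> = tp (Suc t) (\<eta> \<omega>) (responses t \<omega>)"
    using transition[of "Suc t", simplified] AE_space
    by eventually_elim (auto simp: E_def tp_eq_trans_prob indicator_def split: if_splits)
  have "(\<integral>\<^sup>+ \<omega>. H (\<eta> \<omega>, responses t \<omega>) * indicator (latent_event (Suc t) 0) \<omega> \<partial>M) =
      (\<integral>\<^sup>+ \<omega>. ?W \<omega> * indicator (space M - ?A) \<omega> \<partial>M)"
  proof (rule nn_integral_cong)
    fix \<omega> assume "\<omega> \<in> space M"
    then show "H (\<eta> \<omega>, responses t \<omega>) * indicator (latent_event (Suc t) 0) \<omega> = ?W \<omega> * indicator (space M - ?A) \<omega>"
      using latent_cases[of "Suc t" \<omega>] latent_Suc_eq_0[of t \<omega>] by (auto simp: indicator_def)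
  qed
  also have "\<dots> = (\<integral>\<^sup>+ \<omega>. ?W \<omega> * ennreal (1 - tp (Suc t) (\<eta> \<omega>) (responses t \<omega>)) \<partial>M)"
    using A by (intro nn_integral_indicator_eq_cond_exp[OF S _ W])
      (auto intro: eventually_elim2[OF tr real_cond_exp_indicator_compl[OF S A]])
  finally show ?unchanged
    by (simp only: mult_ac)
  note [measurable] = measurable_tp[of "Suc t" t, simplified]
  \<comment> \<open>The changed event is split disjointly by the state at \<open>t\<close>; only the
    second summand involves the transition probability.\<close>
  have "(\<integral>\<^sup>+ \<omega>. H (\<eta> \<omega>, responses t \<omega>) * indicator ?A \<omega> \<partial>M) =
      (\<integral>\<^sup>+ \<omega>. H (\<eta> \<omega>, responses t \<omega>) * indicator (latent_event t 1) \<omega> + ?W \<omega> * indicator ?A \<omega> \<partial>M)"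
  proof (rule nn_integral_cong)
    fix \<omega> assume "\<omega> \<in> space M"
    then show "H (\<eta> \<omega>, responses t \<omega>) * indicator ?A \<omega> =
        H (\<eta> \<omega>, responses t \<omega>) * indicator (latent_event t 1) \<omega> + ?W \<omega> * indicator ?A \<omega>"
      using latent_cases[of "Suc t" \<omega>] latent_cases[of t \<omega>] latent_Suc_eq_0[of t \<omega>]
      by (auto simp: indicator_def)
  qed
  also have "\<dots> = (\<integral>\<^sup>+ \<omega>. H (\<eta> \<omega>, responses t \<omega>) * indicator (latent_event t 1) \<omega> \<partial>M) +
      (\<integral>\<^sup>+ \<omega>. ?W \<omega> * indicator ?A \<omega> \<partial>M)"
    by (intro nn_integral_add) measurable
  also have "(\<integral>\<^sup>+ \<omega>. ?W \<omega> * indicator ?A \<omega> \<partial>M) =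
      (\<integral>\<^sup>+ \<omega>. ?W \<omega> * ennreal (tp (Suc t) (\<eta> \<omega>) (responses t \<omega>)) \<partial>M)"
    by (rule nn_integral_indicator_eq_cond_exp[OF S A W tr])
  finally show ?changed
    by (simp only: mult_ac)
qed

text \<open>The latent state at \<open>Suc t\<close> belongs to the conditioning information, so the
  event \<open>latent_event (Suc t) i\<close> may be carried along as \<open>E\<close> in the
  conditional density lemma, with the history as \<open>Z\<close>.\<close>

lemma nn_integral_response:
  assumes F: "(\<lambda>(z, v). F z v) \<in> borel_measurable ((borel \<Otimes>\<^sub>M response_space t) \<Otimes>\<^sub>M borel)"
  shows "(\<integral>\<^sup>+ \<omega>. F (\<eta> \<omega>, responses t \<omega>) (Y (Suc t) \<omega>) * indicator (latent_event (Suc t) i) \<omega> \<partial>M) =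
    (\<integral>\<^sup>+ \<omega>. (\<integral>\<^sup>+ v. F (\<eta> \<omega>, responses t \<omega>) v *
        ennreal ((if i = 0 then f else g) (treatment (responses t \<omega>) (Suc t)) (\<eta> \<omega>) v) \<partial>\<mu>) *
      indicator (latent_event (Suc t) i) \<omega> \<partial>M)"
proof -
  define E where "E = rv_events M borel \<eta> \<union> obs_events M X Y t \<union>
    rv_events M (count_space UNIV) (X (Suc t)) \<union>
    (\<Union>s\<in>{0..Suc t}. rv_events M (count_space UNIV) (latent \<Theta> s))"
  let ?S = "sigma (space M) E"
  let ?q = "\<lambda>\<omega> v. if latent \<Theta> (Suc t) \<omega> = 0 then f (X (Suc t) \<omega>) (\<eta> \<omega>) v else g (X (Suc t) \<omega>) (\<eta> \<omega>) v"
  have E: "E \<subseteq> sets M"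
    unfolding E_def
    by (intro Un_least UN_least rv_events_subset obs_events_subset) (auto intro: eta_meas measurable_X_UNIV)
  note S = subalgebra_sigma[OF E]
  have "(\<integral>\<^sup>+ \<omega>. F (\<eta> \<omega>, responses t \<omega>) (Y (Suc t) \<omega>) * indicator (latent_event (Suc t) i) \<omega> \<partial>M) =
      (\<integral>\<^sup>+ \<omega>. (\<integral>\<^sup>+ v. F (\<eta> \<omega>, responses t \<omega>) v * ennreal (?q \<omega> v) \<partial>\<mu>) *
        indicator (latent_event (Suc t) i) \<omega> \<partial>M)"
  proof (rule nn_integral_conditional_density[OF S resp.sigma_finite_measure_axioms sets_mu _ _ _ _ _ _ F])
    show "(\<lambda>\<omega>. (\<eta> \<omega>, responses t \<omega>)) \<in> ?S \<rightarrow>\<^sub>M borel \<Otimes>\<^sub>M response_space t"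
      using E by (intro measurable_sigma_history) (auto simp: E_def)
    show "latent_event (Suc t) i \<in> sets ?S"
      using E by (intro sets_sigma_latent_event) (auto simp: E_def)
    show "Y (Suc t) \<in> M \<rightarrow>\<^sub>M borel"
      by (rule Y_meas) simp
    show "(\<lambda>(\<omega>, v). ennreal (?q \<omega> v)) \<in> borel_measurable (M \<Otimes>\<^sub>M \<mu>)"
    proof -
      note [measurable_cong] = sets_mu and [measurable] = eta_meas
      have x: "(\<lambda>z. X (Suc t) (fst z)) \<in> M \<Otimes>\<^sub>M \<mu> \<rightarrow>\<^sub>M count_space {1..K}"
        by (rule measurable_compose[OF measurable_fst measurable_X]) simp
      have [measurable]: "(\<lambda>z. f (X (Suc t) (fst z)) (\<eta> (fst z)) (snd z)) \<in> borel_measurable (M \<Otimes>\<^sub>M \<mu>)"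
        by (rule measurable_response_density[OF f_meas x]) measurable
      have [measurable]: "(\<lambda>z. g (X (Suc t) (fst z)) (\<eta> (fst z)) (snd z)) \<in> borel_measurable (M \<Otimes>\<^sub>M \<mu>)"
        by (rule measurable_response_density[OF g_meas x]) measurable
      show ?thesis
        unfolding split_beta' by measurable
    qed
    show "(\<integral>\<^sup>+ v. ennreal (?q \<omega> v) \<partial>\<mu>) = 1" if "\<omega> \<in> space M" for \<omega>
      using X_range[OF that, of "Suc t"] by (cases "latent \<Theta> (Suc t) \<omega> = 0") (simp_all add: f_dens g_dens)
    show "AE \<omega> in M. real_cond_exp M ?S (indicator {\<omega>\<in>space M. Y (Suc t) \<omega> \<in> B}) \<omega> =
        measure (density \<mu> (\<lambda>v. ennreal (?q \<omega> v))) B" if "B \<in> sets borel" for B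
      using response[of "Suc t" B] that by (simp add: E_def)
  qed
  \<comment> \<open>On the event the state equals \<open>i\<close>, so the choice between
    \<open>f\<close> and \<open>g\<close> no longer depends on the outcome; off the event both
    integrands are 0.\<close>
  also have "\<dots> = (\<integral>\<^sup>+ \<omega>. (\<integral>\<^sup>+ v. F (\<eta> \<omega>, responses t \<omega>) v *
        ennreal ((if i = 0 then f else g) (treatment (responses t \<omega>) (Suc t)) (\<eta> \<omega>) v) \<partial>\<mu>) *
      indicator (latent_event (Suc t) i) \<omega> \<partial>M)"
  proof (rule nn_integral_cong)
    fix \<omega> assume "\<omega> \<in> space M"
    then have "X (Suc t) \<omega> = treatment (responses t \<omega>) (Suc t)"
      by (intro X_eq_treatment_responses) auto
    then show "(\<integral>\<^sup>+ v. F (\<eta> \<omega>, responses t \<omega>) v * ennreal (?q \<omega> v) \<partial>\<mu>) * indicator (latent_event (Suc t) i) \<omega> =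
      (\<integral>\<^sup>+ v. F (\<eta> \<omega>, responses t \<omega>) v *
        ennreal ((if i = 0 then f else g) (treatment (responses t \<omega>) (Suc t)) (\<eta> \<omega>) v) \<partial>\<mu>) *
      indicator (latent_event (Suc t) i) \<omega>"
      by (simp add: indicator_def)
  qed
  finally show ?thesis .
qed

section \<open>Extending the response vector by one coordinate\<close>

lemma nn_integral_responses_Suc:
  assumes "F \<in> borel_measurable (response_space (Suc t))"
  shows "(\<integral>\<^sup>+ y. F y \<partial>PiM {1..Suc t} (\<lambda>_. \<mu>)) = (\<integral>\<^sup>+ y. (\<integral>\<^sup>+ v. F (y(Suc t := v)) \<partial>\<mu>) \<partial>PiM {1..t} (\<lambda>_. \<mu>))"
proof -
  interpret product_sigma_finite "\<lambda>_::nat. \<mu>"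
    by (rule product_sigma_finite_mu)
  have ins: "{1..Suc t} = insert (Suc t) {1..t}"
    by auto
  have "F \<in> borel_measurable (PiM {1..Suc t} (\<lambda>_. \<mu>))"
    using assms measurable_cong_sets[OF sets_PiM_mu refl] by blast
  then show ?thesis
    unfolding ins by (intro product_nn_integral_insert) auto
qed

lemma sigma_finite_PiM_mu: "sigma_finite_measure (PiM {1..t :: nat} (\<lambda>_. \<mu>))"
  by (rule product_sigma_finite.sigma_finite[OF product_sigma_finite_mu]) simp

lemma measurable_update_response:
  assumes F: "F \<in> borel_measurable (borel \<Otimes>\<^sub>M response_space (Suc t))"
  shows "(\<lambda>(z, v). F (fst z, (snd z)(Suc t := v))) \<in> borel_measurable ((borel \<Otimes>\<^sub>M response_space t) \<Otimes>\<^sub>M borel)"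
proof -
  have "(\<lambda>z. (snd (fst z))(Suc t := snd z)) \<in> (borel \<Otimes>\<^sub>M response_space t) \<Otimes>\<^sub>M borel \<rightarrow>\<^sub>M PiM (insert (Suc t) {1..t}) (\<lambda>_. borel)"
    using measurable_compose[OF _ measurable_add_dim[of "Suc t" "{1..t}" "\<lambda>_. borel"],
        of "\<lambda>z. (snd (fst z), snd z)"] by simp
  moreover have "insert (Suc t) {1..t} = {1..Suc t}"
    by auto
  ultimately have "(\<lambda>z. (fst (fst z), (snd (fst z))(Suc t := snd z))) \<in>
      (borel \<Otimes>\<^sub>M response_space t) \<Otimes>\<^sub>M borel \<rightarrow>\<^sub>M borel \<Otimes>\<^sub>M response_space (Suc t)"
    by (intro measurable_Pair measurable_compose[OF measurable_fst measurable_fst]) (simp_all only:)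
  from measurable_compose[OF this F] show ?thesis
    by (simp add: split_beta')
qed

lemma measurable_next_density:
  assumes "\<And>x. x \<in> {1..K} \<Longrightarrow> (\<lambda>(h, v). q x h v) \<in> borel_measurable (borel \<Otimes>\<^sub>M borel)"
  shows "(\<lambda>(z, v). q (treatment (snd z) (Suc t)) (fst z) v :: real) \<in>
    borel_measurable ((borel \<Otimes>\<^sub>M response_space t) \<Otimes>\<^sub>M borel)"
  unfolding split_beta'
proof (rule measurable_response_density[OF assms])
  show "(\<lambda>z. treatment (snd (fst z)) (Suc t)) \<in> (borel \<Otimes>\<^sub>M response_space t) \<Otimes>\<^sub>M borel \<rightarrow>\<^sub>M count_space {1..K}"
    by (rule measurable_compose[OF measurable_compose[OF measurable_fst measurable_snd] measurable_treatment]) auto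
qed auto

text \<open>
  Where \<open>f\<close> vanishes, division by zero makes \<open>odds\<close> vanish, so the identity needs \<open>g\<close> to vanish as well.
\<close>

lemma dens_odds_Suc:
  assumes "f (treatment y (Suc t)) h v = 0 \<longrightarrow> g (treatment y (Suc t)) h v = 0"
  shows "dens (Suc t) h (y(Suc t := v)) * odds (Suc t) h (y(Suc t := v)) =
    dens t h y * (odds t h y + tp (Suc t) h y) * g (treatment y (Suc t)) h v"
proof -
  have "1 - tp (Suc t) h y \<noteq> 0"
    using tp_range(2)[of "Suc t" y h] by simp
  moreover have "g (treatment y (Suc t)) h v = 0" if "f (treatment y (Suc t)) h v = 0"
    using assms that by simp
  ultimately show ?thesis
    by (cases "f (treatment y (Suc t)) h v = 0")
      (simp_all add: no_change_dens_Suc dens_upd odds_upd tp_upd treatment_upd lik_ratio_def)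
qed

text \<open>Both parts go through one induction because the changed mass at \<open>Suc t\<close>
  draws on both states at \<open>t\<close>. \<open>F\<close> stays arbitrary because the induction
  hypothesis is applied to \<open>F\<close> averaged over the new response, possibly times a
  transition factor.\<close>

lemma nn_integral_joint_law:
  assumes F: "F \<in> borel_measurable (borel \<Otimes>\<^sub>M response_space t)"
  shows "(\<integral>\<^sup>+ \<omega>. F (\<eta> \<omega>, responses t \<omega>) * indicator (latent_event t 0) \<omega> \<partial>M) =
      (\<integral>\<^sup>+ h. \<integral>\<^sup>+ y. F (h, y) * ennreal (dens t h y) \<partial>PiM {1..t} (\<lambda>_. \<mu>) \<partial>prior)"
    and "(\<integral>\<^sup>+ \<omega>. F (\<eta> \<omega>, responses t \<omega>) * indicator (latent_event t 1) \<omega> \<partial>M) =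
      (\<integral>\<^sup>+ h. \<integral>\<^sup>+ y. F (h, y) * ennreal (dens t h y * odds t h y) \<partial>PiM {1..t} (\<lambda>_. \<mu>) \<partial>prior)"
  using F
proof (induction t arbitrary: F)
  case 0
  \<comment> \<open>With no responses the product space is a single point, the everywhere undefined
    function.\<close>
  let ?u = "\<lambda>_::nat. undefined :: 'y"
  let ?E = "rv_events M borel \<eta>"
  let ?S = "sigma (space M) ?E"
  let ?A = "latent_event 0 1"
  interpret product_sigma_finite "\<lambda>_::nat. \<mu>"
    by (rule product_sigma_finite_mu)
  have E: "?E \<subseteq> sets M"
    by (rule rv_events_subset[OF eta_meas])
  note S = subalgebra_sigma[OF E]
  have A: "?A \<in> sets M"
    by measurable
  have Fu: "(\<lambda>h. F (h, ?u)) \<in> borel_measurable borel" if "F \<in> borel_measurable (borel \<Otimes>\<^sub>M response_space 0)" for F :: "_ \<Rightarrow> ennreal"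
    by (rule measurable_compose[OF _ that]) (auto intro!: measurable_Pair simp: space_PiM)
  have W: "(\<lambda>\<omega>. F (\<eta> \<omega>, ?u)) \<in> borel_measurable ?S" if "F \<in> borel_measurable (borel \<Otimes>\<^sub>M response_space 0)" for F :: "_ \<Rightarrow> ennreal"
    using E by (intro measurable_compose[OF _ Fu[OF that]] measurable_sigma_rv_events) auto
  have R: "responses 0 \<omega> = ?u" for \<omega>
    by (auto simp: fun_eq_iff)
  have law: "(\<integral>\<^sup>+ \<omega>. G (\<eta> \<omega>) \<partial>M) = (\<integral>\<^sup>+ h. G h \<partial>prior)" if "G \<in> borel_measurable borel" for G
    unfolding eta_law[symmetric] using eta_meas that by (intro nn_integral_distr[symmetric]) auto
  have [measurable]: "p0 \<in> borel_measurable borel"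
    by (rule p0_meas)
  {
    case 1
    note [measurable] = Fu[OF 1]
    have "(\<integral>\<^sup>+ \<omega>. F (\<eta> \<omega>, responses 0 \<omega>) * indicator (latent_event 0 0) \<omega> \<partial>M) =
        (\<integral>\<^sup>+ \<omega>. F (\<eta> \<omega>, ?u) * indicator (space M - ?A) \<omega> \<partial>M)"
    proof (rule nn_integral_cong)
      fix \<omega> assume "\<omega> \<in> space M"
      then show "F (\<eta> \<omega>, responses 0 \<omega>) * indicator (latent_event 0 0) \<omega> = F (\<eta> \<omega>, ?u) * indicator (space M - ?A) \<omega>"
        unfolding R using latent_cases[of 0 \<omega>] by (auto simp: indicator_def)
    qed
    also have "\<dots> = (\<integral>\<^sup>+ \<omega>. F (\<eta> \<omega>, ?u) * ennreal (1 - p0 (\<eta> \<omega>)) \<partial>M)"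
      using A by (intro nn_integral_indicator_eq_cond_exp[OF S _ W[OF 1]])
        (auto intro: eventually_elim2[OF initial real_cond_exp_indicator_compl[OF S A]])
    also have "\<dots> = (\<integral>\<^sup>+ h. F (h, ?u) * ennreal (1 - p0 h) \<partial>prior)"
      by (rule law) measurable
    finally show ?case
      unfolding R by (simp add: nn_integral_empty no_change_dens_def)
  next
    case 2
    note [measurable] = Fu[OF 2]
    have "(\<integral>\<^sup>+ \<omega>. F (\<eta> \<omega>, responses 0 \<omega>) * indicator ?A \<omega> \<partial>M) =
        (\<integral>\<^sup>+ \<omega>. F (\<eta> \<omega>, ?u) * ennreal (p0 (\<eta> \<omega>)) \<partial>M)"
      unfolding R using A by (intro nn_integral_indicator_eq_cond_exp[OF S _ W[OF 2]])
        (auto intro: eventually_mono[OF initial])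
    also have "\<dots> = (\<integral>\<^sup>+ h. F (h, ?u) * ennreal (p0 h) \<partial>prior)"
      by (rule law) measurable
    \<comment> \<open>The prior probability of change is written as initial density times initial
      odds; \<open>p0 h < 1\<close> permits the cancellation.\<close>
    also have "\<dots> = (\<integral>\<^sup>+ h. F (h, ?u) * ennreal ((1 - p0 h) * (p0 h / (1 - p0 h))) \<partial>prior)"
      using p0_range by (intro nn_integral_cong) (simp add: less_imp_neq[symmetric])
    finally show ?case
      unfolding R by (simp add: nn_integral_empty no_change_dens_def)
  }
next
  case (Suc t)
  let ?x = "\<lambda>y. treatment y (Suc t)"
  \<comment> \<open>\<open>?H q F\<close> averages \<open>F\<close> over the new response under the
    density \<open>q\<close>, leaving a test function of the history up to \<open>t\<close>.\<close>
  let ?H = "\<lambda>q (F :: 'h \<times> (nat \<Rightarrow> 'y) \<Rightarrow> ennreal) z. \<integral>\<^sup>+ v. F (fst z, (snd z)(Suc t := v)) * ennreal (q (?x (snd z)) (fst z) v) \<partial>\<mu>"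
  let ?N = "borel \<Otimes>\<^sub>M response_space t"
  have resp_upd: "responses (Suc t) \<omega> = (responses t \<omega>)(Suc t := Y (Suc t) \<omega>)" for \<omega>
    by (auto simp: fun_eq_iff)
  have tp_meas[measurable]: "(\<lambda>z. tp (Suc t) (fst z) (snd z)) \<in> borel_measurable ?N"
    using measurable_tp[of "Suc t" t] by (simp add: split_beta')
  have integrand: "(\<lambda>(z, v). F (fst z, (snd z)(Suc t := v)) * ennreal (q (?x (snd z)) (fst z) v)) \<in> borel_measurable (?N \<Otimes>\<^sub>M \<mu>)"
    if F: "F \<in> borel_measurable (borel \<Otimes>\<^sub>M response_space (Suc t))"
      and q: "\<And>x. x \<in> {1..K} \<Longrightarrow> (\<lambda>(h, v). q x h v) \<in> borel_measurable (borel \<Otimes>\<^sub>M borel)" for F q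
  proof -
    note [measurable] = measurable_update_response[OF F, unfolded split_beta']
      measurable_next_density[where t=t, OF q, unfolded split_beta'] and [measurable_cong] = sets_mu
    show ?thesis
      unfolding split_beta' by measurable
  qed
  have H_meas: "?H q F \<in> borel_measurable ?N"
    if F: "F \<in> borel_measurable (borel \<Otimes>\<^sub>M response_space (Suc t))"
      and q: "\<And>x. x \<in> {1..K} \<Longrightarrow> (\<lambda>(h, v). q x h v) \<in> borel_measurable (borel \<Otimes>\<^sub>M borel)" for F q
    by (rule resp.borel_measurable_nn_integral[OF integrand[OF F q]])
  \<comment> \<open>Time is undone backwards: the response goes first, since its law is given the
    state at \<open>Suc t\<close>, and only then is that state traced back to time
    \<open>t\<close>.\<close>
  have step: "(\<integral>\<^sup>+ \<omega>. F (\<eta> \<omega>, responses (Suc t) \<omega>) * indicator (latent_event (Suc t) i) \<omega> \<partial>M) =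
      (\<integral>\<^sup>+ \<omega>. ?H (if i = 0 then f else g) F (\<eta> \<omega>, responses t \<omega>) * indicator (latent_event (Suc t) i) \<omega> \<partial>M)"
    if "F \<in> borel_measurable (borel \<Otimes>\<^sub>M response_space (Suc t))" for F i
    using nn_integral_response[OF measurable_update_response[OF that], of i]
    by (simp only: resp_upd fst_conv snd_conv)
  \<comment> \<open>A factor depending only on the history is moved under the integral over the new
    response, to be merged there into the next density.\<close>
  have collect: "?H q F (h, y) * ennreal c = (\<integral>\<^sup>+ v. F (h, y(Suc t := v)) * ennreal (c * q (?x y) h v) \<partial>\<mu>)"
    if F: "F \<in> borel_measurable (borel \<Otimes>\<^sub>M response_space (Suc t))"
      and q: "\<And>x. x \<in> {1..K} \<Longrightarrow> (\<lambda>(h, v). q x h v) \<in> borel_measurable (borel \<Otimes>\<^sub>M borel)"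
      and y: "y \<in> space (response_space t)" and c: "0 \<le> c" for F q h y c
  proof -
    have "(h, y) \<in> space ?N"
      using y by (simp add: space_pair_measure)
    from measurable_compose[OF measurable_Pair1'[OF this] integrand[OF F q]]
    have "(\<lambda>v. F (h, y(Suc t := v)) * ennreal (q (?x y) h v)) \<in> borel_measurable \<mu>"
      by simp
    then show ?thesis
      using c by (simp add: ennreal_mult' mult_ac nn_integral_cmult)
  qed
  have unfold: "(\<integral>\<^sup>+ h. \<integral>\<^sup>+ y. F (h, y) * ennreal (d h y) \<partial>PiM {1..Suc t} (\<lambda>_. \<mu>) \<partial>prior) =
      (\<integral>\<^sup>+ h. \<integral>\<^sup>+ y. \<integral>\<^sup>+ v. F (h, y(Suc t := v)) * ennreal (d h (y(Suc t := v))) \<partial>\<mu> \<partial>PiM {1..t} (\<lambda>_. \<mu>) \<partial>prior)"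
    if [measurable]: "F \<in> borel_measurable (borel \<Otimes>\<^sub>M response_space (Suc t))"
      and d: "(\<lambda>(h, y). d h y) \<in> borel_measurable (borel \<Otimes>\<^sub>M response_space (Suc t))" for F d
  proof (rule nn_integral_cong)
    fix h
    have [measurable]: "(\<lambda>y. F (h, y)) \<in> borel_measurable (response_space (Suc t))"
      "(\<lambda>y. d h y) \<in> borel_measurable (response_space (Suc t))"
      using measurable_compose[OF measurable_Pair1' that(1), of h] measurable_compose[OF measurable_Pair1' d, of h]
      by simp_all
    show "(\<integral>\<^sup>+ y. F (h, y) * ennreal (d h y) \<partial>PiM {1..Suc t} (\<lambda>_. \<mu>)) =
      (\<integral>\<^sup>+ y. \<integral>\<^sup>+ v. F (h, y(Suc t := v)) * ennreal (d h (y(Suc t := v))) \<partial>\<mu> \<partial>PiM {1..t} (\<lambda>_. \<mu>))"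
      by (rule nn_integral_responses_Suc) measurable
  qed
  have space_mu: "space (PiM {1..t} (\<lambda>_. \<mu>)) = space (response_space t)"
    by (rule sets_eq_imp_space_eq[OF sets_PiM_mu])
  {
    case 1
    note [measurable] = H_meas[OF 1 f_meas]
    have weighted: "(\<lambda>z. ?H f F z * ennreal (1 - tp (Suc t) (fst z) (snd z))) \<in> borel_measurable ?N"
      by measurable
    have "(\<integral>\<^sup>+ \<omega>. F (\<eta> \<omega>, responses (Suc t) \<omega>) * indicator (latent_event (Suc t) 0) \<omega> \<partial>M) =
        (\<integral>\<^sup>+ \<omega>. ?H f F (\<eta> \<omega>, responses t \<omega>) * indicator (latent_event (Suc t) 0) \<omega> \<partial>M)"
      using step[OF 1, of 0] by (simp only: if_True simp_thms)
    also have "\<dots> = (\<integral>\<^sup>+ \<omega>. ?H f F (\<eta> \<omega>, responses t \<omega>) *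
        ennreal (1 - tp (Suc t) (\<eta> \<omega>) (responses t \<omega>)) * indicator (latent_event t 0) \<omega> \<partial>M)"
      by (rule nn_integral_transition(1)[OF H_meas[OF 1 f_meas]])
    \<comment> \<open>The induction hypothesis is used for \<open>weighted\<close>, which has
      absorbed the no-change factor.\<close>
    also have "\<dots> = (\<integral>\<^sup>+ h. \<integral>\<^sup>+ y. ?H f F (h, y) * ennreal (1 - tp (Suc t) h y) * ennreal (dens t h y)
        \<partial>PiM {1..t} (\<lambda>_. \<mu>) \<partial>prior)"
      using Suc.IH(1)[OF weighted] by (simp only: fst_conv snd_conv)
    also have "\<dots> = (\<integral>\<^sup>+ h. \<integral>\<^sup>+ y. \<integral>\<^sup>+ v. F (h, y(Suc t := v)) * ennreal (dens (Suc t) h (y(Suc t := v)))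
        \<partial>\<mu> \<partial>PiM {1..t} (\<lambda>_. \<mu>) \<partial>prior)"
    proof (intro nn_integral_cong)
      fix h y assume "y \<in> space (PiM {1..t} (\<lambda>_. \<mu>))"
      then have y: "y \<in> space (response_space t)"
        by (simp only: space_mu)
      have t1: "0 \<le> 1 - tp (Suc t) h y"
        using tp_range(2)[of "Suc t" y h] by simp
      have "?H f F (h, y) * ennreal (1 - tp (Suc t) h y) * ennreal (dens t h y) =
          ?H f F (h, y) * ennreal ((1 - tp (Suc t) h y) * dens t h y)"
        by (simp only: ennreal_mult[OF t1 dens_nonneg] mult.assoc)
      also have "\<dots> = (\<integral>\<^sup>+ v. F (h, y(Suc t := v)) * ennreal ((1 - tp (Suc t) h y) * dens t h y * f (?x y) h v) \<partial>\<mu>)"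
        by (rule collect[OF 1 f_meas y mult_nonneg_nonneg[OF t1 dens_nonneg]])
      also have "\<dots> = (\<integral>\<^sup>+ v. F (h, y(Suc t := v)) * ennreal (dens (Suc t) h (y(Suc t := v))) \<partial>\<mu>)"
        by (simp add: no_change_dens_Suc dens_upd tp_upd treatment_upd mult_ac)
      finally show "?H f F (h, y) * ennreal (1 - tp (Suc t) h y) * ennreal (dens t h y) =
        (\<integral>\<^sup>+ v. F (h, y(Suc t := v)) * ennreal (dens (Suc t) h (y(Suc t := v))) \<partial>\<mu>)" .
    qed
    also have "\<dots> = (\<integral>\<^sup>+ h. \<integral>\<^sup>+ y. F (h, y) * ennreal (dens (Suc t) h y) \<partial>PiM {1..Suc t} (\<lambda>_. \<mu>) \<partial>prior)"
      by (rule unfold[OF 1 measurable_dens, symmetric])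
    finally show ?case .
  next
    case 2
    note [measurable] = H_meas[OF 2 g_meas]
    have weighted: "(\<lambda>z. ?H g F z * ennreal (tp (Suc t) (fst z) (snd z))) \<in> borel_measurable ?N"
      by measurable
    have meas[measurable]: "(\<lambda>z. dens t (fst z) (snd z)) \<in> borel_measurable ?N"
        "(\<lambda>z. odds t (fst z) (snd z)) \<in> borel_measurable ?N"
      using measurable_dens[of t] measurable_odds[of t t] by (simp_all add: split_beta')
    interpret \<mu>t: sigma_finite_measure "PiM {1..t} (\<lambda>_. \<mu>)"
      by (rule sigma_finite_PiM_mu)
    have "(\<integral>\<^sup>+ \<omega>. F (\<eta> \<omega>, responses (Suc t) \<omega>) * indicator (latent_event (Suc t) 1) \<omega> \<partial>M) =
        (\<integral>\<^sup>+ \<omega>. ?H g F (\<eta> \<omega>, responses t \<omega>) * indicator (latent_event (Suc t) 1) \<omega> \<partial>M)"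
      using step[OF 2, of 1] by (simp only: if_False one_neq_zero)
    \<comment> \<open>Mass changed by time \<open>t\<close> and mass changing at
      \<open>Suc t\<close>: the second part of the induction hypothesis serves the former, the first
      part the latter. Both respond with density \<open>g\<close>.\<close>
    also have "\<dots> = (\<integral>\<^sup>+ \<omega>. ?H g F (\<eta> \<omega>, responses t \<omega>) * indicator (latent_event t 1) \<omega> \<partial>M) +
        (\<integral>\<^sup>+ \<omega>. ?H g F (\<eta> \<omega>, responses t \<omega>) *
          ennreal (tp (Suc t) (\<eta> \<omega>) (responses t \<omega>)) * indicator (latent_event t 0) \<omega> \<partial>M)"
      by (rule nn_integral_transition(2)[OF H_meas[OF 2 g_meas]])
    also have "(\<integral>\<^sup>+ \<omega>. ?H g F (\<eta> \<omega>, responses t \<omega>) * indicator (latent_event t 1) \<omega> \<partial>M) =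
        (\<integral>\<^sup>+ h. \<integral>\<^sup>+ y. ?H g F (h, y) * ennreal (dens t h y * odds t h y) \<partial>PiM {1..t} (\<lambda>_. \<mu>) \<partial>prior)"
      by (rule Suc.IH(2)[OF H_meas[OF 2 g_meas]])
    also have "(\<integral>\<^sup>+ \<omega>. ?H g F (\<eta> \<omega>, responses t \<omega>) *
          ennreal (tp (Suc t) (\<eta> \<omega>) (responses t \<omega>)) * indicator (latent_event t 0) \<omega> \<partial>M) =
        (\<integral>\<^sup>+ h. \<integral>\<^sup>+ y. ?H g F (h, y) * ennreal (tp (Suc t) h y) * ennreal (dens t h y)
          \<partial>PiM {1..t} (\<lambda>_. \<mu>) \<partial>prior)"
      using Suc.IH(1)[OF weighted] by (simp only: fst_conv snd_conv)
    also have "(\<integral>\<^sup>+ h. \<integral>\<^sup>+ y. ?H g F (h, y) * ennreal (dens t h y * odds t h y) \<partial>PiM {1..t} (\<lambda>_. \<mu>) \<partial>prior) + \<dots> =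
        (\<integral>\<^sup>+ h. \<integral>\<^sup>+ y. ?H g F (h, y) * ennreal (dens t h y * odds t h y) +
          ?H g F (h, y) * ennreal (tp (Suc t) h y) * ennreal (dens t h y) \<partial>PiM {1..t} (\<lambda>_. \<mu>) \<partial>prior)"
    proof -
      let ?a = "\<lambda>z. ?H g F z * ennreal (dens t (fst z) (snd z) * odds t (fst z) (snd z))"
      let ?b = "\<lambda>z. ?H g F z * ennreal (tp (Suc t) (fst z) (snd z)) * ennreal (dens t (fst z) (snd z))"
      have "?a \<in> borel_measurable (prior \<Otimes>\<^sub>M PiM {1..t} (\<lambda>_. \<mu>))"
        "?b \<in> borel_measurable (prior \<Otimes>\<^sub>M PiM {1..t} (\<lambda>_. \<mu>))"
        by measurable
      from \<mu>t.nn_integral_iterated_add[OF this] show ?thesis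
        by (simp only: fst_conv snd_conv)
    qed
    also have "\<dots> = (\<integral>\<^sup>+ h. \<integral>\<^sup>+ y. \<integral>\<^sup>+ v. F (h, y(Suc t := v)) *
        ennreal (dens (Suc t) h (y(Suc t := v)) * odds (Suc t) h (y(Suc t := v)))
        \<partial>\<mu> \<partial>PiM {1..t} (\<lambda>_. \<mu>) \<partial>prior)"
    proof (intro nn_integral_cong)
      fix h y assume "y \<in> space (PiM {1..t} (\<lambda>_. \<mu>))"
      then have y: "y \<in> space (response_space t)"
        by (simp only: space_mu)
      have tp0: "0 \<le> tp (Suc t) h y"
        by (rule tp_range(1)) simp
      have c: "0 \<le> dens t h y * (odds t h y + tp (Suc t) h y)"
        by (intro mult_nonneg_nonneg add_nonneg_nonneg dens_nonneg odds_nonneg tp0)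
      \<comment> \<open>The two sources add up to \<open>odds t h y + tp (Suc t) h y\<close>, the
        bracket in the recursion for \<open>post_odds\<close>.\<close>
      have "?H g F (h, y) * ennreal (dens t h y * odds t h y) +
          ?H g F (h, y) * ennreal (tp (Suc t) h y) * ennreal (dens t h y) =
          ?H g F (h, y) * ennreal (dens t h y * (odds t h y + tp (Suc t) h y))"
        by (simp only: distrib_left ennreal_mult[OF dens_nonneg tp0] mult.assoc
            ennreal_plus[OF mult_nonneg_nonneg[OF dens_nonneg odds_nonneg] mult_nonneg_nonneg[OF dens_nonneg tp0]]
            mult.commute[of "ennreal (tp _ _ _)"])
      also have "\<dots> = (\<integral>\<^sup>+ v. F (h, y(Suc t := v)) *
          ennreal (dens t h y * (odds t h y + tp (Suc t) h y) * g (?x y) h v) \<partial>\<mu>)"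
        by (rule collect[OF 2 g_meas y c])
      also have "\<dots> = (\<integral>\<^sup>+ v. F (h, y(Suc t := v)) *
          ennreal (dens (Suc t) h (y(Suc t := v)) * odds (Suc t) h (y(Suc t := v))) \<partial>\<mu>)"
      \<comment> \<open>\<open>abs_cont\<close> has a null set depending on the parameter and the
        treatment; both are fixed here, as only \<open>v\<close> is integrated.\<close>
      proof (rule nn_integral_cong_AE)
        have "?x y \<in> {1..K}"
          by (rule treatment_range) simp
        from abs_cont[OF this, of h]
        show "AE v in \<mu>. F (h, y(Suc t := v)) * ennreal (dens t h y * (odds t h y + tp (Suc t) h y) * g (?x y) h v) =
          F (h, y(Suc t := v)) * ennreal (dens (Suc t) h (y(Suc t := v)) * odds (Suc t) h (y(Suc t := v)))"
          by eventually_elim (simp only: dens_odds_Suc)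
      qed
      finally show "?H g F (h, y) * ennreal (dens t h y * odds t h y) +
          ?H g F (h, y) * ennreal (tp (Suc t) h y) * ennreal (dens t h y) =
        (\<integral>\<^sup>+ v. F (h, y(Suc t := v)) *
          ennreal (dens (Suc t) h (y(Suc t := v)) * odds (Suc t) h (y(Suc t := v))) \<partial>\<mu>)" .
    qed
    also have "\<dots> = (\<integral>\<^sup>+ h. \<integral>\<^sup>+ y. F (h, y) * ennreal (dens (Suc t) h y * odds (Suc t) h y)
        \<partial>PiM {1..Suc t} (\<lambda>_. \<mu>) \<partial>prior)"
    proof (rule unfold[OF 2, symmetric])
      show "(\<lambda>(h, y). dens (Suc t) h y * odds (Suc t) h y) \<in> borel_measurable (borel \<Otimes>\<^sub>M response_space (Suc t))"
        using measurable_dens[of "Suc t"] measurable_odds[of "Suc t" "Suc t"]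
        by (simp only: split_beta' borel_measurable_times order_refl)
    qed
    finally show ?case .
  }
qed

section \<open>The posterior distribution\<close>

abbreviation marg_dens :: "nat \<Rightarrow> 'h \<Rightarrow> (nat \<Rightarrow> 'y) \<Rightarrow> real" where
  "marg_dens t h y \<equiv> dens t h y * (1 + odds t h y)"

lemma marg_dens_nonneg: "0 \<le> marg_dens t h y"
  using dens_nonneg odds_nonneg by (intro mult_nonneg_nonneg) (auto simp: add_nonneg_nonneg)

lemma measurable_marg_dens:
  "(\<lambda>z. marg_dens t (fst z) (snd z)) \<in> borel_measurable (borel \<Otimes>\<^sub>M response_space t)"
proof -
  have [measurable]: "(\<lambda>z. dens t (fst z) (snd z)) \<in> borel_measurable (borel \<Otimes>\<^sub>M response_space t)"
      "(\<lambda>z. odds t (fst z) (snd z)) \<in> borel_measurable (borel \<Otimes>\<^sub>M response_space t)"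
    using measurable_dens[of t] measurable_odds[of t t] by (simp_all add: split_beta')
  show ?thesis by measurable
qed

text \<open>The two latent states are summed out. The order of integration is then exchanged,
  because for fixed responses the inner prior integrals are those of Bayes' formula.\<close>

lemma nn_integral_marginal_law:
  assumes F[measurable]: "F \<in> borel_measurable (borel \<Otimes>\<^sub>M response_space t)"
  shows "(\<integral>\<^sup>+ \<omega>. F (\<eta> \<omega>, responses t \<omega>) \<partial>M) =
    (\<integral>\<^sup>+ y. \<integral>\<^sup>+ h. F (h, y) * ennreal (marg_dens t h y) \<partial>prior \<partial>PiM {1..t} (\<lambda>_. \<mu>))"
proof -
  interpret \<mu>t: sigma_finite_measure "PiM {1..t} (\<lambda>_. \<mu>)"
    by (rule sigma_finite_PiM_mu)
  interpret prior: prob_space prior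
    by (rule prob_space_prior)
  interpret P: pair_sigma_finite prior "PiM {1..t} (\<lambda>_. \<mu>)"
    by standard
  note [measurable] = measurable_marg_dens
  have [measurable]: "(\<lambda>z. dens t (fst z) (snd z)) \<in> borel_measurable (borel \<Otimes>\<^sub>M response_space t)"
      "(\<lambda>z. odds t (fst z) (snd z)) \<in> borel_measurable (borel \<Otimes>\<^sub>M response_space t)"
    using measurable_dens[of t] measurable_odds[of t t] by (simp_all add: split_beta')
  let ?a = "\<lambda>z. F z * ennreal (dens t (fst z) (snd z))"
  let ?b = "\<lambda>z. F z * ennreal (dens t (fst z) (snd z) * odds t (fst z) (snd z))"
  have "(\<integral>\<^sup>+ \<omega>. F (\<eta> \<omega>, responses t \<omega>) \<partial>M) =
      (\<integral>\<^sup>+ \<omega>. F (\<eta> \<omega>, responses t \<omega>) * indicator (latent_event t 0) \<omega> +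
        F (\<eta> \<omega>, responses t \<omega>) * indicator (latent_event t 1) \<omega> \<partial>M)"
  proof (rule nn_integral_cong)
    fix \<omega> assume "\<omega> \<in> space M"
    then show "F (\<eta> \<omega>, responses t \<omega>) = F (\<eta> \<omega>, responses t \<omega>) * indicator (latent_event t 0) \<omega> +
        F (\<eta> \<omega>, responses t \<omega>) * indicator (latent_event t 1) \<omega>"
      using latent_cases[of t \<omega>] by (auto simp: indicator_def)
  qed
  also have "\<dots> = (\<integral>\<^sup>+ \<omega>. F (\<eta> \<omega>, responses t \<omega>) * indicator (latent_event t 0) \<omega> \<partial>M) +
      (\<integral>\<^sup>+ \<omega>. F (\<eta> \<omega>, responses t \<omega>) * indicator (latent_event t 1) \<omega> \<partial>M)"
    by (rule nn_integral_add) measurable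
  also have "\<dots> = (\<integral>\<^sup>+ h. \<integral>\<^sup>+ y. ?a (h, y) \<partial>PiM {1..t} (\<lambda>_. \<mu>) \<partial>prior) +
      (\<integral>\<^sup>+ h. \<integral>\<^sup>+ y. ?b (h, y) \<partial>PiM {1..t} (\<lambda>_. \<mu>) \<partial>prior)"
    by (simp only: nn_integral_joint_law[OF F] fst_conv snd_conv)
  also have "\<dots> = (\<integral>\<^sup>+ h. \<integral>\<^sup>+ y. ?a (h, y) + ?b (h, y) \<partial>PiM {1..t} (\<lambda>_. \<mu>) \<partial>prior)"
    by (rule \<mu>t.nn_integral_iterated_add) measurable
  also have "\<dots> = (\<integral>\<^sup>+ h. \<integral>\<^sup>+ y. F (h, y) * ennreal (marg_dens t h y) \<partial>PiM {1..t} (\<lambda>_. \<mu>) \<partial>prior)"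
  proof (intro nn_integral_cong)
    fix h y
    have "ennreal (marg_dens t h y) = ennreal (dens t h y) + ennreal (dens t h y * odds t h y)"
      using dens_nonneg[where t=t and h=h and y=y] odds_nonneg[where t=t and h=h and y=y]
      by (simp add: distrib_left flip: ennreal_plus)
    then show "?a (h, y) + ?b (h, y) = F (h, y) * ennreal (marg_dens t h y)"
      by (simp only: fst_conv snd_conv distrib_left)
  qed
  also have "\<dots> = (\<integral>\<^sup>+ y. \<integral>\<^sup>+ h. F (h, y) * ennreal (marg_dens t h y) \<partial>prior \<partial>PiM {1..t} (\<lambda>_. \<mu>))"
  proof (rule P.Fubini'[symmetric])
    have "(\<lambda>z. F z * ennreal (marg_dens t (fst z) (snd z))) \<in> borel_measurable (prior \<Otimes>\<^sub>M PiM {1..t} (\<lambda>_. \<mu>))"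
      by measurable
    then show "(\<lambda>(h, y). F (h, y) * ennreal (marg_dens t h y)) \<in> borel_measurable (prior \<Otimes>\<^sub>M PiM {1..t} (\<lambda>_. \<mu>))"
      by (simp only: split_beta' prod.collapse)
  qed
  finally show ?thesis .
qed

text \<open>Observed treatments are measurable functions of the responses and add no information.
  Testing over the observed sigma-algebra thereby reduces to testing over sets of response
  vectors.\<close>

lemma sets_obs_sigma_subset:
  "sets (obs_sigma M X Y t) \<subseteq> {responses t -` B \<inter> space M |B. B \<in> sets (response_space t)}"
proof -
  let ?V = "vimage_algebra (space M) (responses t) (response_space t)"
  have sub: "responses t \<in> space M \<rightarrow> space (response_space t)"
    using measurable_space[OF measurable_responses] by auto
  have V: "sets ?V = {responses t -` B \<inter> space M |B. B \<in> sets (response_space t)}"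
    by (rule sets_vimage_algebra2[OF sub])
  have resp: "responses t \<in> ?V \<rightarrow>\<^sub>M response_space t"
    by (rule measurable_vimage_algebra1[OF sub])
  have "obs_events M X Y t \<subseteq> sets ?V"
    unfolding obs_events_def
  proof (intro UN_least Un_least)
    fix s assume s: "s \<in> {1..t}"
    have "(\<lambda>\<omega>. treatment (responses t \<omega>) s) \<in> ?V \<rightarrow>\<^sub>M count_space {1..K}"
      using s by (intro measurable_compose[OF resp measurable_treatment]) auto
    then have "(\<lambda>\<omega>. treatment (responses t \<omega>) s) \<in> ?V \<rightarrow>\<^sub>M count_space UNIV"
      by (rule measurable_compose) simp
    moreover have "treatment (responses t \<omega>) s = X s \<omega>" if "\<omega> \<in> space ?V" for \<omega>
      using that s by (intro X_eq_treatment_responses[symmetric]) auto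
    ultimately have "X s \<in> ?V \<rightarrow>\<^sub>M count_space UNIV"
      using measurable_cong[of ?V "\<lambda>\<omega>. treatment (responses t \<omega>) s" "X s"] by blast
    then show "rv_events M (count_space UNIV) (X s) \<subseteq> sets ?V"
      using rv_events_subset[of "X s" ?V] by (simp add: rv_events_def)
    have "(\<lambda>\<omega>. responses t \<omega> s) \<in> ?V \<rightarrow>\<^sub>M borel"
      using s by (intro measurable_compose[OF resp measurable_component_singleton])
    moreover have "(\<lambda>\<omega>. responses t \<omega> s) = Y s"
      using s by (simp only: restrict_apply if_True)
    ultimately have "Y s \<in> ?V \<rightarrow>\<^sub>M borel"
      by simp
    then show "rv_events M borel (Y s) \<subseteq> sets ?V"
      using rv_events_subset[of "Y s" ?V] by (simp add: rv_events_def)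
  qed
  from sets.sigma_sets_subset[OF this] have "sigma_sets (space M) (obs_events M X Y t) \<subseteq> sets ?V"
    by simp
  moreover have "sets (obs_sigma M X Y t) = sigma_sets (space M) (obs_events M X Y t)"
    unfolding obs_sigma_def using obs_events_subset[of t] sets.sets_into_space[where M=M]
    by (intro sets_measure_of) blast
  ultimately show ?thesis
    by (simp only: V)
qed

text \<open>This is the numerator of Bayes' formula; \<open>C = UNIV\<close> gives the denominator,
  the marginal density of the responses. It takes values in \<open>ennreal\<close> because it may be
  infinite on a null set.\<close>

definition evidence :: "nat \<Rightarrow> 'h set \<Rightarrow> (nat \<Rightarrow> 'y) \<Rightarrow> ennreal" where
  "evidence t C y = (\<integral>\<^sup>+ h. ennreal (marg_dens t h y) * indicator C h \<partial>prior)"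

lemma measurable_evidence [measurable]:
  assumes [measurable]: "C \<in> sets borel"
  shows "evidence t C \<in> borel_measurable (response_space t)"
proof -
  interpret prior: prob_space prior
    by (rule prob_space_prior)
  have "(\<lambda>z. (snd z, fst z)) \<in> response_space t \<Otimes>\<^sub>M prior \<rightarrow>\<^sub>M borel \<Otimes>\<^sub>M response_space t"
    by measurable
  from measurable_compose[OF this measurable_marg_dens]
  have [measurable]: "(\<lambda>z. marg_dens t (snd z) (fst z)) \<in> borel_measurable (response_space t \<Otimes>\<^sub>M prior)"
    by (simp only: fst_conv snd_conv)
  show ?thesis
    unfolding evidence_def[abs_def]
    by (rule prior.borel_measurable_nn_integral) (unfold split_beta', measurable)
qed

lemma evidence_mono: "evidence t C y \<le> evidence t UNIV y"
  unfolding evidence_def by (intro nn_integral_mono) (auto simp: indicator_def)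

text \<open>The infinite case is included: the Bochner integral of a nonintegrable function and
  \<open>enn2real\<close> of infinity are both 0.\<close>

lemma integral_marg_dens:
  assumes [measurable]: "C \<in> sets borel" and y: "y \<in> space (response_space t)"
  shows "(\<integral>h. marg_dens t h y * indicator C h \<partial>prior) = enn2real (evidence t C y)"
proof -
  have "(\<lambda>h. (h, y)) \<in> borel \<rightarrow>\<^sub>M borel \<Otimes>\<^sub>M response_space t"
    using y by (rule measurable_Pair2')
  from measurable_compose[OF this measurable_marg_dens]
  have [measurable]: "(\<lambda>h. marg_dens t h y) \<in> borel_measurable borel"
    by (simp only: fst_conv snd_conv)
  have "(\<integral>h. marg_dens t h y * indicator C h \<partial>prior) =
      enn2real (\<integral>\<^sup>+ h. ennreal (marg_dens t h y * indicator C h) \<partial>prior)"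
  proof (rule integral_eq_nn_integral)
    show "(\<lambda>h. marg_dens t h y * indicator C h) \<in> borel_measurable prior"
      by measurable
    show "AE h in prior. 0 \<le> marg_dens t h y * indicator C h"
      by (intro AE_I2 mult_nonneg_nonneg[OF marg_dens_nonneg]) simp
  qed
  also have "(\<integral>\<^sup>+ h. ennreal (marg_dens t h y * indicator C h) \<partial>prior) = evidence t C y"
    unfolding evidence_def by (intro nn_integral_cong) (simp only: ennreal_mult'[OF marg_dens_nonneg] ennreal_indicator)
  finally show ?thesis .
qed

lemma nn_integral_evidence:
  assumes [measurable]: "C \<in> sets borel" "G \<in> borel_measurable (response_space t)"
  shows "(\<integral>\<^sup>+ \<omega>. G (responses t \<omega>) * indicator C (\<eta> \<omega>) \<partial>M) =
    (\<integral>\<^sup>+ y. G y * evidence t C y \<partial>PiM {1..t} (\<lambda>_. \<mu>))"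
proof -
  have F: "(\<lambda>z. G (snd z) * indicator C (fst z)) \<in> borel_measurable (borel \<Otimes>\<^sub>M response_space t)"
    by measurable
  have "(\<integral>\<^sup>+ \<omega>. G (responses t \<omega>) * indicator C (\<eta> \<omega>) \<partial>M) =
      (\<integral>\<^sup>+ y. \<integral>\<^sup>+ h. G y * indicator C h * ennreal (marg_dens t h y) \<partial>prior \<partial>PiM {1..t} (\<lambda>_. \<mu>))"
    using nn_integral_marginal_law[OF F] by (simp only: fst_conv snd_conv)
  also have "\<dots> = (\<integral>\<^sup>+ y. G y * evidence t C y \<partial>PiM {1..t} (\<lambda>_. \<mu>))"
  proof (rule nn_integral_cong)
    fix y assume "y \<in> space (PiM {1..t} (\<lambda>_. \<mu>))"
    then have y: "y \<in> space (response_space t)"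
      by (simp only: sets_eq_imp_space_eq[OF sets_PiM_mu])
    from measurable_compose[OF measurable_Pair2'[OF this] measurable_marg_dens]
    have [measurable]: "(\<lambda>h. marg_dens t h y) \<in> borel_measurable borel"
      by (simp only: fst_conv snd_conv)
    have "(\<lambda>h. ennreal (marg_dens t h y) * indicator C h) \<in> borel_measurable prior"
      by measurable
    from nn_integral_cmult[OF this, of "G y"]
    show "(\<integral>\<^sup>+ h. G y * indicator C h * ennreal (marg_dens t h y) \<partial>prior) = G y * evidence t C y"
      unfolding evidence_def by (simp only: mult_ac)
  qed
  finally show ?thesis .
qed

text \<open>The marginal density integrates to the total mass 1, so it is finite almost
  everywhere.\<close>

lemma AE_evidence_finite: "AE y in PiM {1..t} (\<lambda>_. \<mu>). evidence t UNIV y \<noteq> \<infinity>"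
proof (rule nn_integral_PInf_AE)
  show "evidence t UNIV \<in> borel_measurable (PiM {1..t} (\<lambda>_. \<mu>))"
    by measurable
  have "(\<integral>\<^sup>+ y. evidence t UNIV y \<partial>PiM {1..t} (\<lambda>_. \<mu>)) = (\<integral>\<^sup>+ \<omega>. 1 * indicator UNIV (\<eta> \<omega>) \<partial>M)"
    using nn_integral_evidence[of UNIV "\<lambda>_. 1"] by simp
  then show "(\<integral>\<^sup>+ y. evidence t UNIV y \<partial>PiM {1..t} (\<lambda>_. \<mu>)) \<noteq> \<infinity>"
    by (simp add: emeasure_space_1)
qed

text \<open>The quotient \<open>r\<close> is bounded and depends only on the responses, so it
  suffices to compare integrals over observed events. After passage to \<mu>^t these agree because
  \<open>r\<close> times the denominator is the numerator wherever the denominator is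
  finite.\<close>

lemma posterior:
  assumes C[measurable]: "C \<in> sets borel"
  shows "AE \<omega> in M. real_cond_exp M (obs_sigma M X Y t) (indicator {\<omega>\<in>space M. \<eta> \<omega> \<in> C}) \<omega> =
    enn2real (evidence t C (responses t \<omega>)) / enn2real (evidence t UNIV (responses t \<omega>))"
proof -
  let ?S = "obs_sigma M X Y t"
  let ?A = "{\<omega>\<in>space M. \<eta> \<omega> \<in> C}"
  define r where "r y = enn2real (evidence t C y) / enn2real (evidence t UNIV y)" for y
  have r_meas[measurable]: "r \<in> borel_measurable (response_space t)"
    unfolding r_def[abs_def] by measurable
  have S: "subalgebra M ?S"
    unfolding obs_sigma_def by (rule subalgebra_sigma[OF obs_events_subset])
  interpret finite_measure_subalgebra M ?S
    by standard (rule S)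
  have r_resp: "(\<lambda>\<omega>. r (responses t \<omega>)) \<in> borel_measurable M"
    by measurable
  note [measurable] = eta_meas
  have [measurable]: "?A \<in> sets M"
    by measurable
  have r_nonneg: "0 \<le> r y" for y
    by (simp add: r_def)
  \<comment> \<open>An infinite denominator becomes 0 under \<open>enn2real\<close>, and division by
    0 gives 0, so the bound holds everywhere and makes \<open>r\<close> integrable.\<close>
  have r_le: "r y \<le> 1" for y
  proof (cases "evidence t UNIV y = \<infinity>")
    case False
    then have "enn2real (evidence t C y) \<le> enn2real (evidence t UNIV y)"
      by (intro enn2real_mono evidence_mono) (simp add: less_top)
    then show ?thesis
      by (auto simp: r_def divide_le_eq_1 less_le)
  qed (simp add: r_def)
  have r_mult: "ennreal (r y) * evidence t UNIV y = evidence t C y" if fin: "evidence t UNIV y \<noteq> \<infinity>" for y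
  proof -
    have "evidence t C y < top"
      using evidence_mono[of t C y] fin by (metis infinity_ennreal_def less_top order_le_less_trans)
    then obtain a where a: "evidence t C y = ennreal a" "0 \<le> a"
      by (cases "evidence t C y") auto
    obtain b where b: "evidence t UNIV y = ennreal b" "0 \<le> b"
      using fin by (cases "evidence t UNIV y") auto
    \<comment> \<open>In the case \<open>b = 0\<close> this forces \<open>a = 0\<close>, so the
      product identity survives division by zero.\<close>
    have "a \<le> b"
      using evidence_mono[of t C y] a b by simp
    with a b show ?thesis
      by (auto simp: r_def simp flip: ennreal_mult)
  qed
  have key: "(\<integral>\<^sup>+ \<omega>. indicator B (responses t \<omega>) * ennreal (r (responses t \<omega>)) \<partial>M) =
      (\<integral>\<^sup>+ \<omega>. indicator B (responses t \<omega>) * indicator C (\<eta> \<omega>) \<partial>M)"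
    if B[measurable]: "B \<in> sets (response_space t)" for B
  proof -
    have G: "(\<lambda>y. indicator B y * ennreal (r y)) \<in> borel_measurable (response_space t)"
      by measurable
    \<comment> \<open>On the left the parameter is unrestricted, so the denominator appears as the
      weight and cancels against \<open>r\<close>.\<close>
    have "(\<integral>\<^sup>+ \<omega>. indicator B (responses t \<omega>) * ennreal (r (responses t \<omega>)) \<partial>M) =
        (\<integral>\<^sup>+ y. indicator B y * ennreal (r y) * evidence t UNIV y \<partial>PiM {1..t} (\<lambda>_. \<mu>))"
      using nn_integral_evidence[OF sets.top[of borel, unfolded space_borel] G] by (simp only: indicator_UNIV mult_1_right)
    also have "\<dots> = (\<integral>\<^sup>+ y. indicator B y * evidence t C y \<partial>PiM {1..t} (\<lambda>_. \<mu>))"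
    proof (rule nn_integral_cong_AE)
      show "AE y in PiM {1..t} (\<lambda>_. \<mu>). indicator B y * ennreal (r y) * evidence t UNIV y = indicator B y * evidence t C y"
        using AE_evidence_finite[of t] by eventually_elim (metis mult.assoc r_mult)
    qed
    also have "\<dots> = (\<integral>\<^sup>+ \<omega>. indicator B (responses t \<omega>) * indicator C (\<eta> \<omega>) \<partial>M)"
      using nn_integral_evidence[OF C borel_measurable_indicator[OF B]] by (rule sym)
    finally show ?thesis .
  qed
  have "AE \<omega> in M. real_cond_exp M ?S (indicator ?A) \<omega> = r (responses t \<omega>)"
  proof (rule real_cond_exp_charact)
    show "integrable M (indicator ?A :: 'w \<Rightarrow> real)"
      by (simp add: less_top[symmetric])
    show "integrable M (\<lambda>\<omega>. r (responses t \<omega>))"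
      by (rule integrable_const_bound[where B=1, OF _ r_resp]) (simp add: r_nonneg r_le)
    show "(\<lambda>\<omega>. r (responses t \<omega>)) \<in> borel_measurable ?S"
      unfolding obs_sigma_def
      by (rule measurable_compose[OF measurable_sigma_responses[OF order_refl obs_events_subset] r_meas])
  next
    fix D assume "D \<in> sets ?S"
    then obtain B where B[measurable]: "B \<in> sets (response_space t)" and D: "D = responses t -` B \<inter> space M"
      using sets_obs_sigma_subset by blast
    have "(\<integral>\<omega>\<in>D. (indicator ?A \<omega> :: real) \<partial>M) =
        (\<integral>\<omega>. indicator B (responses t \<omega>) * indicator C (\<eta> \<omega>) \<partial>M)"
      unfolding set_lebesgue_integral_def by (intro Bochner_Integration.integral_cong) (auto simp: D indicator_def)
    also have "\<dots> = enn2real (\<integral>\<^sup>+ \<omega>. ennreal (indicator B (responses t \<omega>) * indicator C (\<eta> \<omega>)) \<partial>M)"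
    proof (rule integral_eq_nn_integral)
      show "(\<lambda>\<omega>. indicator B (responses t \<omega>) * indicator C (\<eta> \<omega>) :: real) \<in> borel_measurable M"
        by measurable
    qed simp
    also have "\<dots> = enn2real (\<integral>\<^sup>+ \<omega>. ennreal (indicator B (responses t \<omega>) * r (responses t \<omega>)) \<partial>M)"
      using key[OF B] by (simp only: ennreal_mult'[OF indicator_pos_le] ennreal_indicator)
    also have "\<dots> = (\<integral>\<omega>. indicator B (responses t \<omega>) * r (responses t \<omega>) \<partial>M)"
    proof (rule integral_eq_nn_integral[symmetric])
      show "(\<lambda>\<omega>. indicator B (responses t \<omega>) * r (responses t \<omega>)) \<in> borel_measurable M"
        by measurable
    qed (simp add: r_nonneg)
    also have "\<dots> = (\<integral>\<omega>\<in>D. r (responses t \<omega>) \<partial>M)"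
      unfolding set_lebesgue_integral_def by (intro Bochner_Integration.integral_cong) (auto simp: D indicator_def)
    finally show "(\<integral>\<omega>\<in>D. indicator ?A \<omega> \<partial>M) = (\<integral>\<omega>\<in>D. r (responses t \<omega>) \<partial>M)" .
  qed
  then show ?thesis
    by (simp only: r_def)
qed

lemma marg_dens_responses:
  assumes "\<omega> \<in> space M"
  shows "no_change_dens p0 p f (\<lambda>s. X s \<omega>) (\<lambda>s. Y s \<omega>) t h * (1 + post_odds p0 p f g (\<lambda>s. X s \<omega>) (\<lambda>s. Y s \<omega>) t h) =
    marg_dens t h (responses t \<omega>)"
proof -
  have x: "X s \<omega> = treatment (responses t \<omega>) s" if "1 \<le> s" "s \<le> t" for s
    using assms that by (intro X_eq_treatment_responses) auto
  have y: "Y s \<omega> = responses t \<omega> s" if "1 \<le> s" "s \<le> t" for s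
    using that by simp
  have "no_change_dens p0 p f (\<lambda>s. X s \<omega>) (\<lambda>s. Y s \<omega>) t h = dens t h (responses t \<omega>)"
    by (rule no_change_dens_cong[OF x y])
  moreover have "post_odds p0 p f g (\<lambda>s. X s \<omega>) (\<lambda>s. Y s \<omega>) t h = odds t h (responses t \<omega>)"
    by (rule post_odds_cong[OF x y])
  ultimately show ?thesis
    by (simp only:)
qed

end

theorem lemmaH1:
  fixes M :: "'w measure"
    and \<mu> :: "'y::polish_space measure"
    and K :: nat
    and prior :: "'h::polish_space measure"
    and p0 :: "'h \<Rightarrow> real"
    and p :: "nat \<Rightarrow> 'h \<Rightarrow> nat list \<Rightarrow> real"
    and f g :: "nat \<Rightarrow> 'h \<Rightarrow> 'y \<Rightarrow> real"
    and \<eta> :: "'w \<Rightarrow> 'h"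
    and \<Theta> :: "'w \<Rightarrow> enat"
    and X :: "nat \<Rightarrow> 'w \<Rightarrow> nat"
    and Y :: "nat \<Rightarrow> 'w \<Rightarrow> 'y"
    and t :: nat
    and C :: "'h set"
  assumes "change_point_model M \<mu> K prior p0 p f g \<eta> \<Theta> X Y"
    and "C \<in> sets borel"
  shows "AE \<omega> in M.
    real_cond_exp M (obs_sigma M X Y t) (indicator {\<omega>\<in>space M. \<eta> \<omega> \<in> C}) \<omega> =
      (\<integral>h. no_change_dens p0 p f (\<lambda>s. X s \<omega>) (\<lambda>s. Y s \<omega>) t h *
             (1 + post_odds p0 p f g (\<lambda>s. X s \<omega>) (\<lambda>s. Y s \<omega>) t h) * indicator C h \<partial>prior) /
      (\<integral>h. no_change_dens p0 p f (\<lambda>s. X s \<omega>) (\<lambda>s. Y s \<omega>) t h *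
             (1 + post_odds p0 p f g (\<lambda>s. X s \<omega>) (\<lambda>s. Y s \<omega>) t h) \<partial>prior)"
proof -
  interpret change_point_model M \<mu> K prior p0 p f g \<eta> \<Theta> X Y
    by fact
  show ?thesis
    using posterior[OF assms(2), of t] AE_space
  proof eventually_elim
    case (elim \<omega>)
    have y: "responses t \<omega> \<in> space (response_space t)"
      by (rule measurable_space[OF measurable_responses elim(2)])
    \<comment> \<open>The denominator is the numerator's formula at \<open>C = UNIV\<close>.\<close>
    have "(\<integral>h. marg_dens t h (responses t \<omega>) \<partial>prior) = enn2real (evidence t UNIV (responses t \<omega>))"
      using integral_marg_dens[OF sets.top[of borel, unfolded space_borel] y] by (simp only: indicator_UNIV mult_1_right)
    with elim(1) integral_marg_dens[OF assms(2) y] show ?case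
      by (simp only: marg_dens_responses[OF elim(2)])
  qed
qed

end
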